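(* Let $(G,q_1,\theta_1)$ and $(\Gamma,q_2,\theta_2)$ be involutive metric groups with $|G|\neq|\Gamma|$, with $\mathcal{G}(q_1)=-\mathcal{G}(q_2)$, and with an isomorphism $(G^{\theta_1},q_1|_{G^{\theta_1}})\cong(\Gamma^{\theta_2},q_2|_{\Gamma^{\theta_2}})$, by means of which both are identified with one group $(U,q_0)$, regarded as a common subgroup of $G$ and $\Gamma$. Let $S$ be the $J\times J$ matrix defined in the context and let $$N_{x,y,z}=\sum_{w\in J}\frac{S_{w,x}S_{w,y}S_{w,z}}{S_{(0,0),w}}\qquad(x,y,z\in J).$$ Then all the numbers $N_{x,y,z}$ are non-negative integers if and only if one of the following holds: (i) $|\Gamma|=|G|+4|U|$; (ii) $|\Gamma|=|G|+2|U|$ and $|G|/|U|$ is an even number.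
   Context: A metric group $(G,q)$ is a finite abelian group $G$ with a map $q:G\to\mathbb{T}=\{z\in\mathbb{C}:|z|=1\}$ such that $q(-g)=q(g)$ and $\langle g,h\rangle_q=q(g+h)q(g)^{-1}q(h)^{-1}$ is a non-degenerate bicharacter. $\mathcal{G}(q)=\frac{1}{\sqrt{|G|}}\sum_{g\in G}q(g)$. An involutive metric group $(G,q,\theta)$ is a metric group with $\theta\in\mathrm{Aut}(G)$, $\theta^2=\mathrm{id}$, $q\circ\theta=q$; $G^\theta=\{g\in G:\theta(g)=g\}$. The subscript of $\langle\cdot,\cdot\rangle_{q_i}$ and of $\theta_i$ is suppressed when clear. Put $a=1/\sqrt{|G|}$, $b=1/\sqrt{|\Gamma|}$. Fix subsets $G_*\subset G$, $\Gamma_*\subset\Gamma$ with $G=U\sqcup G_*\sqcup\theta_1(G_* )$ and $\Gamma=U\sqcup\Gamma_*\sqcup\theta_2(\Gamma_* )$. Let $J=(U\times\{0,\pi\})\sqcup G_*\sqcup\Gamma_*$. With blocks indexed in order by $U\times\{0\}$, $U\times\{\pi\}$, $G_*$, $\Gamma_*$ (row index $u,u,g,\gamma$; column index $u',u',g',\gamma'$; bars denote complex conjugation): $$S=\begin{pmatrix} \frac{a-b}{2}\overline{\langle u,u'\rangle}& \frac{a+b}{2}\overline{\langle u,u'\rangle}&a\overline{\langle u,g'\rangle} &b\overline{\langle u,\gamma'\rangle}\\ \frac{a+b}{2}\overline{\langle u,u'\rangle}& \frac{a-b}{2}\overline{\langle u,u'\rangle}&a\overline{\langle u,g'\rangle}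 &-b\overline{\langle u,\gamma'\rangle}\\ a\overline{\langle g,u'\rangle}&a\overline{\langle g,u'\rangle}&a(\overline{\langle g,g'\rangle+\langle\theta(g),g'\rangle})&0\\ b\overline{\langle\gamma,u'\rangle}&-b\overline{\langle\gamma,u'\rangle}&0&-b(\overline{\langle\gamma,\gamma'\rangle+\langle\theta(\gamma),\gamma'\rangle}) \end{pmatrix}.$$ *)

theory Defs
  imports Complex_Main "HOL-Library.Cardinality"
begin

text \<open>
  A finite abelian group is a type of sort \<open>{ab_group_add, finite}\<close>; its order is \<open>CARD\<close>.
\<close>

definition pairing :: "('a::ab_group_add \<Rightarrow> complex) \<Rightarrow> 'a \<Rightarrow> 'a \<Rightarrow> complex" where
  "pairing q g h = q (g + h) * inverse (q g) * inverse (q h)"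

definition bicharacter :: "('a::ab_group_add \<Rightarrow> 'a \<Rightarrow> complex) \<Rightarrow> bool" where
  "bicharacter \<beta> \<longleftrightarrow>
     (\<forall>g h. cmod (\<beta> g h) = 1) \<and>
     (\<forall>g h k. \<beta> (g + h) k = \<beta> g k * \<beta> h k) \<and>
     (\<forall>g h k. \<beta> g (h + k) = \<beta> g h * \<beta> g k)"

definition nondegenerate :: "('a::ab_group_add \<Rightarrow> 'a \<Rightarrow> complex) \<Rightarrow> bool" where
  "nondegenerate \<beta> \<longleftrightarrow>
     (\<forall>g. (\<forall>h. \<beta> g h = 1) \<longrightarrow> g = 0) \<and> (\<forall>h. (\<forall>g. \<beta> g h = 1) \<longrightarrow> h = 0)"

definition metric_group :: "('a::{ab_group_add, finite} \<Rightarrow> complex) \<Rightarrow> bool" where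
  "metric_group q \<longleftrightarrow>
     (\<forall>g. cmod (q g) = 1) \<and> (\<forall>g. q (- g) = q g) \<and>
     bicharacter (pairing q) \<and> nondegenerate (pairing q)"

definition gauss_sum :: "('a::{ab_group_add, finite} \<Rightarrow> complex) \<Rightarrow> complex" where
  "gauss_sum q = complex_of_real (1 / sqrt (real CARD('a))) * (\<Sum>g\<in>UNIV. q g)"

definition involutive_metric_group ::
    "('a::{ab_group_add, finite} \<Rightarrow> complex) \<Rightarrow> ('a \<Rightarrow> 'a) \<Rightarrow> bool" where
  "involutive_metric_group q \<theta> \<longleftrightarrow>
     metric_group q \<and> additive \<theta> \<and> bij \<theta> \<and> \<theta> \<circ> \<theta> = id \<and> q \<circ> \<theta> = q"

definition fixed_points :: "('a \<Rightarrow> 'a) \<Rightarrow> 'a set" where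
  "fixed_points \<theta> = {g. \<theta> g = g}"

text \<open>
  \<open>metric_iso A q B r \<phi>\<close>: the map \<open>\<phi>\<close> restricts to an isomorphism from the subgroup \<open>A\<close>, with
  \<open>q\<close> restricted to it, onto the subgroup \<open>B\<close>, with \<open>r\<close> restricted to it.  Values of \<open>\<phi>\<close>
  outside \<open>A\<close> are irrelevant.  The restrictions of \<open>q\<close> and \<open>r\<close> may be degenerate.
\<close>

definition metric_iso ::
    "'a::ab_group_add set \<Rightarrow> ('a \<Rightarrow> complex) \<Rightarrow> 'b::ab_group_add set \<Rightarrow> ('b \<Rightarrow> complex) \<Rightarrow>
     ('a \<Rightarrow> 'b) \<Rightarrow> bool" where
  "metric_iso A q B r \<phi> \<longleftrightarrow>
     bij_betw \<phi> A B \<and> (\<forall>x\<in>A. \<forall>y\<in>A. \<phi> (x + y) = \<phi> x + \<phi> y) \<and> (\<forall>x\<in>A. r (\<phi> x) = q x)"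

text \<open>The whole group is the disjoint union of the fixed points, \<open>X\<close> and \<open>\<theta> ` X\<close>.\<close>

definition orbit_choice :: "('a \<Rightarrow> 'a) \<Rightarrow> 'a set \<Rightarrow> bool" where
  "orbit_choice \<theta> X \<longleftrightarrow>
     fixed_points \<theta> \<union> X \<union> \<theta> ` X = UNIV \<and>
     fixed_points \<theta> \<inter> X = {} \<and> fixed_points \<theta> \<inter> \<theta> ` X = {} \<and> X \<inter> \<theta> ` X = {}"

text \<open>
  The group \<open>U\<close> is realised as the fixed points of \<open>\<theta>1\<close> in \<open>G\<close>; its copy in \<open>\<Gamma>\<close> is the image
  under \<open>\<phi>\<close>.  The constructors \<open>U0\<close> and \<open>Upi\<close> stand for the pairs \<open>(u, 0)\<close> and \<open>(u, \<pi>)\<close>.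
\<close>

datatype ('g, 'h) label = U0 'g | Upi 'g | InG 'g | InGamma 'h

definition index_set :: "('g \<Rightarrow> 'g) \<Rightarrow> 'g set \<Rightarrow> 'h set \<Rightarrow> ('g, 'h) label set" where
  "index_set \<theta>1 Gs \<Gamma>s =
     U0 ` fixed_points \<theta>1 \<union> Upi ` fixed_points \<theta>1 \<union> InG ` Gs \<union> InGamma ` \<Gamma>s"

definition S_matrix ::
    "('g::{ab_group_add, finite} \<Rightarrow> complex) \<Rightarrow> ('g \<Rightarrow> 'g) \<Rightarrow>
     ('h::{ab_group_add, finite} \<Rightarrow> complex) \<Rightarrow> ('h \<Rightarrow> 'h) \<Rightarrow> ('g \<Rightarrow> 'h) \<Rightarrow>
     ('g, 'h) label \<Rightarrow> ('g, 'h) label \<Rightarrow> complex" where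
  "S_matrix q1 \<theta>1 q2 \<theta>2 \<phi> x y =
     (let a = complex_of_real (1 / sqrt (real CARD('g)));
          b = complex_of_real (1 / sqrt (real CARD('h)));
          p = pairing q1;
          r = pairing q2
      in case x of
           U0 u \<Rightarrow>
             (case y of
                U0 u' \<Rightarrow> (a - b) / 2 * cnj (p u u')
              | Upi u' \<Rightarrow> (a + b) / 2 * cnj (p u u')
              | InG g' \<Rightarrow> a * cnj (p u g')
              | InGamma \<gamma>' \<Rightarrow> b * cnj (r (\<phi> u) \<gamma>'))
         | Upi u \<Rightarrow>
             (case y of
                U0 u' \<Rightarrow> (a + b) / 2 * cnj (p u u')
              | Upi u' \<Rightarrow> (a - b) / 2 * cnj (p u u')
              | InG g' \<Rightarrow> a * cnj (p u g')
              | InGamma \<gamma>' \<Rightarrow> - b * cnj (r (\<phi> u) \<gamma>'))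
         | InG g \<Rightarrow>
             (case y of
                U0 u' \<Rightarrow> a * cnj (p g u')
              | Upi u' \<Rightarrow> a * cnj (p g u')
              | InG g' \<Rightarrow> a * cnj (p g g' + p (\<theta>1 g) g')
              | InGamma \<gamma>' \<Rightarrow> 0)
         | InGamma \<gamma> \<Rightarrow>
             (case y of
                U0 u' \<Rightarrow> b * cnj (r \<gamma> (\<phi> u'))
              | Upi u' \<Rightarrow> - b * cnj (r \<gamma> (\<phi> u'))
              | InG g' \<Rightarrow> 0
              | InGamma \<gamma>' \<Rightarrow> - b * cnj (r \<gamma> \<gamma>' + r (\<theta>2 \<gamma>) \<gamma>')))"

text \<open>The Verlinde formula for a matrix \<open>S\<close> over a finite index set \<open>J\<close> with unit label \<open>e\<close>.\<close>

definition verlinde :: "'j set \<Rightarrow> ('j \<Rightarrow> 'j \<Rightarrow> complex) \<Rightarrow> 'j \<Rightarrow> 'j \<Rightarrow> 'j \<Rightarrow> 'j \<Rightarrow> complex" where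
  "verlinde J S e x y z = (\<Sum>w\<in>J. S w x * S w y * S w z / S e w)"

end

theory Submission
  imports Defs
begin

text \<open>
  Every column of \<open>S\<close> is, on each of the two copies of \<open>U\<close>, a multiple of one character, and on
  \<open>G\<^sub>*\<close> and \<open>\<Gamma>\<^sub>*\<close> a sum of characters over a \<open>\<theta>\<close>-orbit.  Orthogonality therefore gives
  \<open>N = 4 \<epsilon> \<tau> / (|\<Gamma>| - |G|) + T\<^sub>1 / 2 \<plusminus> T\<^sub>2 / 2\<close>, where \<open>\<tau>\<close> is 0 or \<open>|U|\<close>, \<open>\<epsilon>\<close> is 0 or 1, and
  \<open>T\<^sub>1\<close>, \<open>T\<^sub>2\<close> count the triples with sum 0 in a product of three orbits in \<open>G\<close>, respectively \<open>\<Gamma>\<close>.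
  If one of the orbits in \<open>G\<close> is free then \<open>T\<^sub>1\<close> is even, and if one of those in \<open>\<Gamma>\<close> is free
  then \<open>T\<^sub>2\<close> is 0 or 2; hence integrality amounts to \<open>|\<Gamma>| - |G|\<close> being positive and dividing \<open>4 |U|\<close>.

  As \<open>|U|\<close> divides both orders, \<open>|\<Gamma>| = |G| + d |U|\<close> with \<open>d\<close> one of 1, 2, 4.
  Put \<open>H = (1 - \<theta>) G\<close>, of order \<open>|G| / |U|\<close>.  It has odd order iff \<open>q\<close> is non-degenerate on \<open>U\<close>,
  a condition shared by \<open>G\<close> and \<open>\<Gamma>\<close>; this excludes \<open>d = 1\<close>.  In the odd case \<open>G\<close> is the
  orthogonal sum of \<open>U\<close> and \<open>H\<close>, and pairing off \<open>h\<close> and \<open>-h\<close> shows that the Gauss sum of \<open>H\<close> is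
  \<open>1 + 2 y\<close> for an algebraic integer \<open>y\<close>.  Its square is thus 1 modulo 4, and so the equality of the
  normalised squares for \<open>G\<close> and \<open>\<Gamma>\<close> rules out \<open>d = 2\<close>.
\<close>

section \<open>Fixed-point-free involutions\<close>

text \<open>The orbits are removed one pair \<open>{x, f x}\<close> at a time, so the induction is
  on the cardinality of \<open>A\<close>.\<close>

lemma involution_transversal:
  assumes "finite A" and "\<And>x. x \<in> A \<Longrightarrow> f x \<in> A" and "\<And>x. x \<in> A \<Longrightarrow> f (f x) = x"
    and "\<And>x. x \<in> A \<Longrightarrow> f x \<noteq> x"
  shows "\<exists>B. B \<subseteq> A \<and> B \<inter> f ` B = {} \<and> A = B \<union> f ` B"
  using assms
proof (induction "card A" arbitrary: A rule: less_induct)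
  case less
  show ?case
  proof (cases "A = {}")
    case False
    then obtain x where x: "x \<in> A" by blast
    define A' where "A' = A - {x, f x}"
    have "card A' < card A"
      unfolding A'_def using x less.prems(1) by (intro psubset_card_mono) auto
    moreover have closed: "f y \<in> A'" if "y \<in> A'" for y
      using that less.prems(2-3) x unfolding A'_def by (metis Diff_iff insert_iff empty_iff)
    ultimately obtain B where B: "B \<subseteq> A'" "B \<inter> f ` B = {}" "A' = B \<union> f ` B"
      using less.hyps[of A'] less.prems unfolding A'_def by auto
    have "insert x B \<subseteq> A" using B x A'_def by auto
    moreover have "insert x B \<inter> f ` insert x B = {}"
      using B closed x less.prems(4)[OF x] unfolding A'_def by auto
    moreover have "A = insert x B \<union> f ` insert x B"
      using B(3) x less.prems(2)[OF x] unfolding A'_def by auto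
    ultimately show ?thesis by blast
  qed auto
qed

lemma sum_transversal:
  fixes g :: "'a \<Rightarrow> 'b::comm_semiring_1"
  assumes "finite B" and "inj_on f B" and "B \<inter> f ` B = {}" and "\<And>x. x \<in> B \<Longrightarrow> g (f x) = g x"
  shows "sum g (B \<union> f ` B) = 2 * sum g B"
proof -
  have "sum g (B \<union> f ` B) = sum g B + sum g (f ` B)"
    using assms by (intro sum.union_disjoint) auto
  also have "sum g (f ` B) = sum g B"
    using assms by (subst sum.reindex) (auto intro: sum.cong)
  finally show ?thesis by (simp add: mult_2)
qed

lemma even_card_involution:
  assumes "finite A" and "\<And>x. x \<in> A \<Longrightarrow> f x \<in> A" and "\<And>x. x \<in> A \<Longrightarrow> f (f x) = x"
    and "\<And>x. x \<in> A \<Longrightarrow> f x \<noteq> x"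
  shows "even (card A)"
proof -
  obtain B where B: "B \<subseteq> A" "B \<inter> f ` B = {}" "A = B \<union> f ` B"
    using involution_transversal[of A f] assms by blast
  have "inj_on f B" using assms(3) B(1) by (metis inj_onI subsetD)
  moreover have "finite B" using B(1) assms(1) finite_subset by blast
  ultimately have "sum (\<lambda>_. 1::nat) A = 2 * sum (\<lambda>_. 1) B"
    using sum_transversal[of B f "\<lambda>_. 1::nat"] B by auto
  then show ?thesis by simp
qed

section \<open>Integer combinations of roots of unity\<close>

text \<open>This is the ring generated by the \<open>N\<close>-th roots of unity. Closure under
  differences alone suffices: as 1 is a root of unity, it yields 0, negatives and sums, and products
  of roots are again roots.\<close>

inductive_set cyclotomic_integers :: "nat \<Rightarrow> complex set" for N where
  root: "z ^ N = 1 \<Longrightarrow> z \<in> cyclotomic_integers N"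
| diff: "x \<in> cyclotomic_integers N \<Longrightarrow> y \<in> cyclotomic_integers N \<Longrightarrow> x - y \<in> cyclotomic_integers N"

lemma cyclotomic_integers_1 [simp]: "1 \<in> cyclotomic_integers N"
  by (rule root) simp

lemma cyclotomic_integers_0 [simp]: "0 \<in> cyclotomic_integers N"
  using diff[of 1 N 1] by simp

lemma cyclotomic_integers_uminus: "x \<in> cyclotomic_integers N \<Longrightarrow> - x \<in> cyclotomic_integers N"
  using diff[of 0 N x] by simp

lemma cyclotomic_integers_add:
  "x \<in> cyclotomic_integers N \<Longrightarrow> y \<in> cyclotomic_integers N \<Longrightarrow> x + y \<in> cyclotomic_integers N"
  using diff[of x N "- y"] cyclotomic_integers_uminus by simp

lemma cyclotomic_integers_mult:
  assumes "x \<in> cyclotomic_integers N" and "y \<in> cyclotomic_integers N"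
  shows "x * y \<in> cyclotomic_integers N"
  using assms(1)
proof induction
  case (root z)
  from assms(2) show ?case
  proof induction
    case (root w)
    with \<open>z ^ N = 1\<close> show ?case
      by (intro cyclotomic_integers.root) (simp add: power_mult_distrib)
  qed (simp add: right_diff_distrib cyclotomic_integers.diff)
qed (simp add: left_diff_distrib cyclotomic_integers.diff)

lemma cyclotomic_integers_sum:
  "(\<And>i. i \<in> A \<Longrightarrow> f i \<in> cyclotomic_integers N) \<Longrightarrow> sum f A \<in> cyclotomic_integers N"
  by (induction A rule: infinite_finite_induct) (auto intro: cyclotomic_integers_add)

lemma cyclotomic_integers_of_nat: "of_nat k \<in> cyclotomic_integers N"
  by (induction k) (auto intro: cyclotomic_integers_add)

text \<open>For positive \<open>N\<close> the roots form a finite generating set of the additive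
  group, as the elimination below requires.\<close>

lemma cyclotomic_integers_span:
  assumes "x \<in> cyclotomic_integers N" and "N > 0"
  shows "\<exists>a. x = (\<Sum>z | z ^ N = 1. of_int (a z) * z)"
  using assms(1)
proof induction
  case (root z)
  have "finite {z::complex. z ^ N = 1}" using assms(2) by (intro finite_roots_unity) simp
  then have "(\<Sum>w | w ^ N = 1. of_int (if w = z then 1 else 0) * w) = z"
    using root by (simp add: if_distrib[of of_int] if_distrib[of "\<lambda>t. t * _"] sum.delta' cong: if_cong)
  then show ?case by (intro exI[of _ "\<lambda>w. if w = z then 1 else 0"]) (rule sym)
next
  case (diff x y)
  then obtain a b where "x = (\<Sum>z | z ^ N = 1. of_int (a z) * z)"
    "y = (\<Sum>z | z ^ N = 1. of_int (b z) * z)" by blast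
  then have "x - y = (\<Sum>z | z ^ N = 1. of_int (a z - b z) * z)"
    by (simp add: sum_subtractf left_diff_distrib)
  then show ?case by (rule exI[where x = "\<lambda>z. a z - b z"])
qed

text \<open>
  Nakayama's lemma at the prime 2, by eliminating one generator at a time; the odd factors
  \<open>c\<close> stand for units of the localisation.
\<close>

lemma two_divisible_span_trivial:
  fixes B :: "complex set"
  assumes "finite B"
    and "\<And>b. b \<in> B \<Longrightarrow> \<exists>(c::int) a. odd c \<and> of_int c * b = 2 * (\<Sum>x\<in>B. of_int (a x) * x)"
  shows "\<forall>b\<in>B. b = 0"
  using assms
proof (induction B rule: finite_induct)
  case (insert b B)
  let ?S = "\<lambda>a. \<Sum>x\<in>B. of_int (a x :: int) * x"
  have split: "\<exists>(c::int) a. odd c \<and> of_int c * y = 2 * (of_int (a b) * b + ?S a)"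
    if "y \<in> insert b B" for y
    using insert.prems[OF that] by (simp only: sum.insert[OF insert.hyps])
  obtain c a where c: "odd (c::int)" "of_int c * b = 2 * (of_int (a b) * b + ?S a)"
    using split[of b] by blast
  \<comment> \<open>The multiple of \<open>b\<close> on the right has an even coefficient, so moving
    it to the left keeps the coefficient odd.\<close>
  define e where "e = c - 2 * a b"
  have odd_e: "odd e" using c(1) by (simp add: e_def)
  have "of_int e * b = of_int c * b - 2 * (of_int (a b) * b)"
    by (simp add: e_def left_diff_distrib)
  then have e: "of_int e * b = 2 * ?S a" unfolding c(2) by (simp add: distrib_left)
  have "\<forall>x\<in>B. x = 0"
  proof (rule insert.IH)
    fix y assume "y \<in> B"
    then obtain c' a' where c': "odd (c'::int)" "of_int c' * y = 2 * (of_int (a' b) * b + ?S a')"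
      using split[of y] by blast
    \<comment> \<open>Scaling by \<open>e\<close> makes \<open>b\<close> occur only as
      \<open>e * b\<close>, which the previous relation replaces by a combination of the remaining
      generators.\<close>
    have "of_int (e * c') * y = of_int e * (of_int c' * y)" by simp
    also have "\<dots> = 2 * (of_int (a' b) * (of_int e * b) + of_int e * ?S a')"
      unfolding c'(2) by (simp only: distrib_left mult.left_commute)
    also have "\<dots> = 2 * (of_int (2 * a' b) * ?S a + of_int e * ?S a')"
      unfolding e by simp
    finally have "of_int (e * c') * y = 2 * (of_int (2 * a' b) * ?S a + of_int e * ?S a')" .
    moreover have "of_int (2 * a' b) * ?S a + of_int e * ?S a' = ?S (\<lambda>x. 2 * a' b * a x + e * a' x)"
      unfolding sum_distrib_left sum.distrib[symmetric]
      by (intro sum.cong) (simp_all add: distrib_right mult.assoc)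
    ultimately have "of_int (e * c') * y = 2 * ?S (\<lambda>x. 2 * a' b * a x + e * a' x)"
      by (simp only:)
    moreover have "odd (e * c')" using odd_e c'(1) by simp
    ultimately show "\<exists>(c::int) a. odd c \<and> of_int c * y = 2 * ?S a" by (intro exI conjI)
  qed
  moreover have "b = 0"
  proof -
    have "of_int e * b = 0" using e \<open>\<forall>x\<in>B. x = 0\<close> by (simp add: sum.neutral)
    moreover have "e \<noteq> 0" using odd_e by auto
    ultimately show ?thesis by simp
  qed
  ultimately show ?case by simp
qed simp

text \<open>If 2 had an inverse \<open>z\<close> in the ring, every root \<open>b\<close> would
  equal \<open>2 * (z * b)\<close>, so the generators would be divisible by 2 within their own span
  and hence vanish. But 1 is one of them.\<close>

lemma two_not_unit_cyclotomic_integers: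
  assumes "z \<in> cyclotomic_integers N" and "N > 0"
  shows "2 * z \<noteq> 1"
proof
  assume z: "2 * z = 1"
  have "\<forall>b\<in>{b::complex. b ^ N = 1}. b = 0"
  proof (rule two_divisible_span_trivial)
    show "finite {z::complex. z ^ N = 1}" using assms(2) by (intro finite_roots_unity) simp
    fix b :: complex assume "b \<in> {b. b ^ N = 1}"
    then have "z * b \<in> cyclotomic_integers N"
      using cyclotomic_integers_mult[OF assms(1) root] by simp
    then obtain a where "z * b = (\<Sum>z | z ^ N = 1. of_int (a z) * z)"
      using cyclotomic_integers_span assms(2) by blast
    moreover have "of_int 1 * b = 2 * (z * b)" using z by (simp flip: mult.assoc)
    ultimately have "of_int 1 * b = 2 * (\<Sum>z | z ^ N = 1. of_int (a z) * z)" by simp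
    then show "\<exists>(c::int) a. odd c \<and> of_int c * b = 2 * (\<Sum>x\<in>{b. b ^ N = 1}. of_int (a x) * x)"
      by (intro exI conjI) (rule odd_one)
  qed
  then show False by (auto dest!: spec[of _ 1])
qed

section \<open>Characters\<close>

text \<open>Translation by \<open>g\<close> permutes the group, so it preserves the product of all
  values while multiplying it by one factor \<open>\<chi> g\<close> per element.\<close>

lemma character_power_card:
  fixes \<chi> :: "'a::{ab_group_add, finite} \<Rightarrow> complex"
  assumes "\<And>x y. \<chi> (x + y) = \<chi> x * \<chi> y" and "\<And>x. \<chi> x \<noteq> 0"
  shows "\<chi> g ^ CARD('a) = 1"
proof -
  have "(\<Prod>h\<in>UNIV. \<chi> h) = (\<Prod>h\<in>UNIV. \<chi> (g + h))"
    by (rule prod.reindex_bij_witness[of _ "\<lambda>h. g + h" "\<lambda>h. h - g"]) auto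
  also have "\<dots> = \<chi> g ^ CARD('a) * (\<Prod>h\<in>UNIV. \<chi> h)"
    by (simp add: assms(1) prod.distrib)
  finally show ?thesis using assms(2) by simp
qed

lemma character_sum:
  fixes \<chi> :: "'a::ab_group_add \<Rightarrow> complex"
  assumes "\<And>x y. x \<in> A \<Longrightarrow> y \<in> A \<Longrightarrow> x + y \<in> A" and "\<And>x. x \<in> A \<Longrightarrow> - x \<in> A"
    and "\<And>x y. x \<in> A \<Longrightarrow> y \<in> A \<Longrightarrow> \<chi> (x + y) = \<chi> x * \<chi> y"
  shows "sum \<chi> A = (if \<forall>x\<in>A. \<chi> x = 1 then of_nat (card A) else 0)"
proof (cases "\<forall>x\<in>A. \<chi> x = 1")
  case False
  then obtain g where g: "g \<in> A" "\<chi> g \<noteq> 1" by blast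
  have "sum \<chi> A = (\<Sum>h\<in>A. \<chi> (g + h))"
    using assms(1)[OF g(1)] assms(1)[OF _ assms(2)[OF g(1)]]
    by (intro sum.reindex_bij_witness[of _ "\<lambda>h. g + h" "\<lambda>h. h - g"]) auto
  also have "\<dots> = \<chi> g * sum \<chi> A"
    by (simp add: assms(3) g(1) sum_distrib_left)
  finally have "sum \<chi> A = 0" using g(2) by simp
  then show ?thesis using False by auto
qed simp

section \<open>Involutive metric groups\<close>

locale involutive_metric =
  fixes q :: "'a::{ab_group_add, finite} \<Rightarrow> complex" and \<theta> :: "'a \<Rightarrow> 'a"
  assumes involutive_metric_group: "involutive_metric_group q \<theta>"
begin

abbreviation e :: "'a \<Rightarrow> 'a \<Rightarrow> complex" where "e \<equiv> pairing q"

definition U :: "'a set" where "U = fixed_points \<theta>"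

text \<open>The orthogonal complement of \<open>U\<close>: orthogonality is \<open>e_U_H\<close>,
  and the order is the right one by \<open>card_U_H\<close>.\<close>

definition H :: "'a set" where "H = range (\<lambda>g. g - \<theta> g)"

lemma metric: "metric_group q"
  using involutive_metric_group by (simp add: involutive_metric_group_def)

lemma q_nonzero [simp]: "q g \<noteq> 0"
  using metric unfolding metric_group_def by (metis norm_zero zero_neq_one)

lemma q_cnj [simp]: "q g * cnj (q g) = 1"
  using metric by (simp add: metric_group_def complex_norm_square[symmetric])

lemma q_uminus [simp]: "q (- g) = q g"
  using metric by (simp add: metric_group_def)

lemma q_\<theta> [simp]: "q (\<theta> g) = q g"
  using involutive_metric_group unfolding involutive_metric_group_def by (metis comp_apply)

lemma \<theta>_add: "\<theta> (g + h) = \<theta> g + \<theta> h"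
  using involutive_metric_group unfolding involutive_metric_group_def by (simp add: additive.add)

lemma \<theta>_\<theta> [simp]: "\<theta> (\<theta> g) = g"
  using involutive_metric_group unfolding involutive_metric_group_def by (metis comp_apply id_apply)

lemma \<theta>_0 [simp]: "\<theta> 0 = 0"
  using \<theta>_add[of 0 0] by simp

lemma \<theta>_uminus: "\<theta> (- g) = - \<theta> g"
  using \<theta>_add[of g "- g"] by (simp add: eq_neg_iff_add_eq_0 add.commute)

lemma \<theta>_diff: "\<theta> (g - h) = \<theta> g - \<theta> h"
  using \<theta>_add[of g "- h"] by (simp add: \<theta>_uminus)

lemma inj_\<theta>: "inj \<theta>"
  by (metis \<theta>_\<theta> injI)

lemma U_iff: "u \<in> U \<longleftrightarrow> \<theta> u = u"
  by (simp add: U_def fixed_points_def)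

lemma U_0 [simp]: "0 \<in> U"
  and U_add: "u \<in> U \<Longrightarrow> v \<in> U \<Longrightarrow> u + v \<in> U"
  and U_uminus: "u \<in> U \<Longrightarrow> - u \<in> U"
  by (simp_all add: U_iff \<theta>_add \<theta>_uminus)

lemma U_nonempty [simp]: "U \<noteq> {}"
  using U_0 by (metis empty_iff)

lemma card_U_pos: "card U > 0"
  by (simp add: card_gt_0_iff)

lemma e_add_left: "e (g + h) k = e g k * e h k"
  and e_add_right: "e g (h + k) = e g h * e g k"
  and e_norm: "cmod (e g h) = 1"
  using metric by (simp_all add: metric_group_def bicharacter_def)

lemma e_nonzero [simp]: "e g h \<noteq> 0"
  using e_norm[of g h] by auto

lemma e_commute: "e g h = e h g"
  by (simp add: pairing_def add.commute mult.commute mult.left_commute)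

lemma e_\<theta>_\<theta> [simp]: "e (\<theta> g) (\<theta> h) = e g h"
  by (simp add: pairing_def flip: \<theta>_add)

lemma e_\<theta>_left: "e (\<theta> g) h = e g (\<theta> h)"
  by (metis e_\<theta>_\<theta> \<theta>_\<theta>)

lemma e_0_right [simp]: "e g 0 = 1"
  using e_add_right[of g 0 0] by simp

lemma e_0_left [simp]: "e 0 g = 1"
  by (subst e_commute) simp

lemma e_uminus_right: "e g (- h) * e g h = 1"
  by (simp flip: e_add_right)

lemma q_0 [simp]: "q 0 = 1"
  using e_0_right[of 0] by (simp add: pairing_def)

lemma q_add: "q (g + h) = q g * q h * e g h"
  by (simp add: pairing_def field_simps)

text \<open>Since \<open>q\<close> is even, pairing \<open>g\<close> with \<open>- g\<close> gives
  the inverse square of \<open>q g\<close>; bimultiplicativity inverts it.\<close>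

lemma e_self: "e g g = q g ^ 2"
proof -
  have "e g (- g) * q g ^ 2 = 1"
    by (simp add: pairing_def power2_eq_square field_simps)
  then show ?thesis using e_uminus_right[of g g] e_nonzero[of g "-g"]
    by (metis mult_left_cancel)
qed

lemma nondegenerate_iff: "(\<forall>g. e g h = 1) \<longleftrightarrow> h = 0"
  using metric by (auto simp: metric_group_def nondegenerate_def)

lemma sum_e: "(\<Sum>g\<in>UNIV. e g h) = (if h = 0 then of_nat CARD('a) else 0)"
  using character_sum[of UNIV "\<lambda>g. e g h"] nondegenerate_iff[of h] by (simp add: e_add_left)

text \<open>The pairing of \<open>g\<close> with itself is a character value, hence a root of unity,
  and it is the square of \<open>q g\<close>. This places all sums of values of \<open>q\<close> in
  a cyclotomic ring.\<close>

lemma q_root: "q g ^ (2 * CARD('a)) = 1"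
  using character_power_card[of "e g" g] by (simp add: e_add_right e_self power_mult)

text \<open>The squared modulus is the group order: after the shift of \<open>g\<close> by
  \<open>h\<close>, summing the character over \<open>h\<close> leaves only the term
  \<open>g = 0\<close>.\<close>

lemma gauss_sum_nonzero: "(\<Sum>g\<in>UNIV. q g) \<noteq> 0"
proof -
  have "(\<Sum>g\<in>UNIV. q g) * cnj (\<Sum>g\<in>UNIV. q g) = (\<Sum>h\<in>UNIV. \<Sum>g\<in>UNIV. q g * cnj (q h))"
    by (subst sum.swap) (simp add: sum_product cnj_sum)
  also have "\<dots> = (\<Sum>h\<in>UNIV. \<Sum>g\<in>UNIV. q (h + g) * cnj (q h))"
  proof (rule sum.cong)
    fix h
    show "(\<Sum>g\<in>UNIV. q g * cnj (q h)) = (\<Sum>g\<in>UNIV. q (h + g) * cnj (q h))"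
      by (rule sum.reindex_bij_witness[of _ "\<lambda>g. h + g" "\<lambda>g. g - h"]) auto
  qed simp
  also have "\<dots> = (\<Sum>h\<in>UNIV. \<Sum>g\<in>UNIV. q g * e h g)"
  proof (intro sum.cong refl)
    fix h g
    have "q (h + g) * cnj (q h) = (q h * cnj (q h)) * (q g * e h g)"
      by (simp add: q_add mult_ac del: q_cnj)
    then show "q (h + g) * cnj (q h) = q g * e h g" by simp
  qed
  also have "\<dots> = (\<Sum>g\<in>UNIV. q g * (\<Sum>h\<in>UNIV. e h g))"
    by (subst sum.swap) (simp add: sum_distrib_left)
  also have "\<dots> = of_nat CARD('a)"
    by (simp add: sum_e if_distrib[of "\<lambda>t. _ * t"] cong: if_cong)
  finally show ?thesis by auto
qed

section \<open>The subgroup (1 - \<theta>) G and its position relative to U\<close>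

lemma H_0 [simp]: "0 \<in> H"
  unfolding H_def by (rule range_eqI[of _ _ 0]) simp

lemma H_uminus: "h \<in> H \<Longrightarrow> - h \<in> H"
proof -
  assume "h \<in> H"
  then obtain g where "h = g - \<theta> g" unfolding H_def by blast
  then have "- h = (- g) - \<theta> (- g)" by (simp add: \<theta>_uminus)
  then show ?thesis unfolding H_def by (rule range_eqI)
qed

lemma H_add: "h \<in> H \<Longrightarrow> k \<in> H \<Longrightarrow> h + k \<in> H"
proof -
  assume "h \<in> H" "k \<in> H"
  then obtain g g' where "h = g - \<theta> g" "k = g' - \<theta> g'" unfolding H_def by blast
  then have "h + k = (g + g') - \<theta> (g + g')" by (simp add: \<theta>_add)
  then show ?thesis unfolding H_def by (rule range_eqI)
qed

lemma \<theta>_H: "h \<in> H \<Longrightarrow> \<theta> h = - h"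
  unfolding H_def by (auto simp: \<theta>_diff)

lemma e_U_H: "u \<in> U \<Longrightarrow> h \<in> H \<Longrightarrow> e u h = 1"
proof -
  assume u: "u \<in> U" and "h \<in> H"
  then obtain g where h: "h = g - \<theta> g" unfolding H_def by blast
  have "e u h * e u (\<theta> g) = e u g" by (simp add: h flip: e_add_right)
  moreover have "e u (\<theta> g) = e u g" using u e_\<theta>_left[of u g] by (simp add: U_iff)
  ultimately show ?thesis by simp
qed

text \<open>The fibres of \<open>g - \<theta> g\<close> over its image \<open>H\<close> are the
  cosets of \<open>U\<close>.\<close>

lemma card_U_H: "CARD('a) = card U * card H"
proof -
  let ?f = "\<lambda>g. g - \<theta> g"
  have "card {g. ?f g = h} = card U" if hH: "h \<in> H" for h
  proof -
    obtain g where h: "h = ?f g" using hH unfolding H_def by blast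
    have "bij_betw (\<lambda>u. g + u) U {g. ?f g = h}"
      by (rule bij_betw_byWitness[of _ "\<lambda>x. x - g"])
        (auto simp: U_iff h \<theta>_add \<theta>_diff algebra_simps)
    then show ?thesis by (rule bij_betw_same_card[symmetric])
  qed
  then have "card (\<Union>h\<in>H. {g. ?f g = h}) = (\<Sum>h\<in>H. card U)"
    by (subst card_UN_disjoint) auto
  moreover have "(\<Union>h\<in>H. {g. ?f g = h}) = UNIV" unfolding H_def by auto
  ultimately show ?thesis by simp
qed

text \<open>An element of the intersection is both fixed and negated by \<open>\<theta>\<close>. If
  it is non-zero it has order 2, and translation by it splits \<open>H\<close> into pairs.\<close>

lemma U_Int_H_trivial_if_odd:
  assumes "odd (card H)"
  shows "U \<inter> H = {0}"
proof (rule ccontr)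
  assume "U \<inter> H \<noteq> {0}"
  then obtain x where x: "x \<in> U" "x \<in> H" "x \<noteq> 0" using U_0 H_0 by blast
  then have "x = - x" using \<theta>_H U_iff by metis
  then have "x + x = 0" by (metis add.right_inverse)
  then have "even (card H)"
    by (intro even_card_involution[of H "\<lambda>h. h + x"]) (use x H_add in \<open>auto simp: add.assoc\<close>)
  then show False using assms by simp
qed

text \<open>Injectivity is the trivial intersection; surjectivity then follows by counting with
  \<open>card_U_H\<close>.\<close>

lemma bij_betw_U_H:
  assumes "U \<inter> H = {0}"
  shows "bij_betw (\<lambda>(u, h). u + h) (U \<times> H) UNIV"
proof -
  have inj: "inj_on (\<lambda>(u, h). u + h) (U \<times> H)"
  proof (rule inj_onI, clarify)
    fix u h u' h' assume *: "u \<in> U" "h \<in> H" "u' \<in> U" "h' \<in> H" "u + h = u' + h'"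
    then have "u + - u' = h' + - h" by (simp add: algebra_simps)
    then have "u + - u' \<in> U \<inter> H"
      using * U_add U_uminus H_add H_uminus by (metis IntI)
    then have "u = u'" using assms by (simp add: add_eq_0_iff)
    then show "u = u' \<and> h = h'" using * by simp
  qed
  moreover have "(\<lambda>(u, h). u + h) ` (U \<times> H) = UNIV"
    using inj by (intro card_subset_eq) (auto simp: card_image card_U_H)
  ultimately show ?thesis by (simp add: bij_betw_def)
qed

lemma U_plus_H: "U \<inter> H = {0} \<Longrightarrow> \<exists>u\<in>U. \<exists>h\<in>H. g = u + h"
proof -
  assume "U \<inter> H = {0}"
  then have "g \<in> (\<lambda>(u, h). u + h) ` (U \<times> H)" using bij_betw_imp_surj_on[OF bij_betw_U_H] by simp
  then show ?thesis by auto
qed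

text \<open>The right-hand side refers only to \<open>U\<close> and the form on it, so the condition
  can be carried from one group to the other along the isomorphism of fixed points.\<close>

lemma U_Int_H_trivial_iff_nondegenerate:
  "U \<inter> H = {0} \<longleftrightarrow> (\<forall>u\<in>U. (\<forall>w\<in>U. e u w = 1) \<longrightarrow> u = 0)"
proof
  assume R: "\<forall>u\<in>U. (\<forall>w\<in>U. e u w = 1) \<longrightarrow> u = 0"
  have "x = 0" if x: "x \<in> U" "x \<in> H" for x
  proof -
    have "e x w = 1" if "w \<in> U" for w
      using e_U_H[OF that x(2)] e_commute[of x w] by simp
    then show ?thesis using R x(1) by blast
  qed
  then show "U \<inter> H = {0}" by auto
next
  assume L: "U \<inter> H = {0}"
  show "\<forall>u\<in>U. (\<forall>w\<in>U. e u w = 1) \<longrightarrow> u = 0"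
  proof (intro ballI impI)
    fix u assume u: "u \<in> U" "\<forall>w\<in>U. e u w = 1"
    have "e g u = 1" for g
    proof -
      obtain w h where "w \<in> U" "h \<in> H" "g = w + h"
        using U_plus_H[OF L] by blast
      then have "e u g = 1" using u e_U_H by (simp add: e_add_right)
      then show ?thesis by (simp add: e_commute[of g])
    qed
    then show "u = 0" using nondegenerate_iff by blast
  qed
qed

lemma H_no_involution: "U \<inter> H = {0} \<Longrightarrow> h \<in> H - {0} \<Longrightarrow> - h \<noteq> h"
proof
  assume disj: "U \<inter> H = {0}" and h: "h \<in> H - {0}" and "- h = h"
  have "\<theta> h = - h" using h \<theta>_H by blast
  also note \<open>- h = h\<close>
  finally have "h \<in> U" by (simp only: U_iff)
  then show False using disj h by blast
qed

lemma odd_card_H: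
  assumes "U \<inter> H = {0}"
  shows "odd (card H)"
proof -
  have "even (card (H - {0}))"
    by (rule even_card_involution[of _ uminus]) (simp_all add: H_uminus H_no_involution[OF assms])
  moreover have "card H = Suc (card (H - {0}))" by (rule card.remove) simp_all
  ultimately show ?thesis by (simp only: even_Suc not_not)
qed

lemma sum_q_decompose:
  assumes "U \<inter> H = {0}"
  shows "(\<Sum>g\<in>UNIV. q g) = sum q U * sum q H"
proof -
  have "(\<Sum>g\<in>UNIV. q g) = (\<Sum>(u, h)\<in>U \<times> H. q (u + h))"
    by (subst sum.reindex_bij_betw[OF bij_betw_U_H[OF assms], symmetric]) (simp add: case_prod_beta)
  also have "\<dots> = (\<Sum>(u, h)\<in>U \<times> H. q u * q h)"
    by (intro sum.cong) (auto simp: q_add e_U_H)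
  also have "\<dots> = sum q U * sum q H"
    unfolding sum_product sum.cartesian_product ..
  finally show ?thesis .
qed

text \<open>\<open>N\<close> may be any multiple of \<open>2 * CARD('a)\<close>, so that the sums
  for two different groups can be placed in one ring.\<close>

lemma sum_q_H:
  assumes "U \<inter> H = {0}" and "2 * CARD('a) dvd N"
  shows "\<exists>y\<in>cyclotomic_integers N. sum q H = 1 + 2 * y"
proof -
  obtain B where B: "B \<subseteq> H - {0}" "B \<inter> uminus ` B = {}" "H - {0} = B \<union> uminus ` B"
    using involution_transversal[of "H - {0}" uminus] H_no_involution[OF assms(1)] H_uminus by auto
  have "sum q H = 1 + sum q (H - {0})" using sum.remove[of H 0 q] by simp
  also have "sum q (H - {0}) = 2 * sum q B"
    unfolding B(3) using B(2) by (intro sum_transversal) auto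
  moreover have "sum q B \<in> cyclotomic_integers N"
  proof (intro cyclotomic_integers_sum root)
    show "q g ^ N = 1" for g using assms(2) q_root[of g] by (auto simp: power_mult)
  qed
  ultimately show ?thesis by auto
qed

section \<open>Zero-sum triples in products of orbits\<close>

definition triples :: "'a set \<Rightarrow> 'a set \<Rightarrow> 'a set \<Rightarrow> ('a \<times> 'a \<times> 'a) set" where
  "triples A B C = {(x, y, z). x \<in> A \<and> y \<in> B \<and> z \<in> C \<and> x + y + z = 0}"

text \<open>Expanding the product turns it into character values at \<open>x + y + z\<close>, and
  orthogonality retains the terms with sum 0. The abstract \<open>f\<close> allows for the complex
  conjugate of the pairing.\<close>

lemma sum_triples:
  fixes f :: "'a \<Rightarrow> 'a \<Rightarrow> complex"
  assumes "\<And>g h k. f g (h + k) = f g h * f g k"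
    and "\<And>h. (\<Sum>g\<in>UNIV. f g h) = (if h = 0 then of_nat CARD('a) else 0)"
  shows "(\<Sum>g\<in>UNIV. sum (f g) A * sum (f g) B * sum (f g) C) =
    of_nat CARD('a) * of_nat (card (triples A B C))"
proof -
  have "(\<Sum>g\<in>UNIV. sum (f g) A * sum (f g) B * sum (f g) C) =
      (\<Sum>g\<in>UNIV. \<Sum>(x, y, z)\<in>A \<times> B \<times> C. f g (x + y + z))"
  proof (rule sum.cong)
    fix g
    have "sum (f g) A * sum (f g) B * sum (f g) C = sum (f g) A * (sum (f g) B * sum (f g) C)"
      by (rule mult.assoc)
    also have "\<dots> = (\<Sum>x\<in>A. \<Sum>y\<in>B. \<Sum>z\<in>C. f g x * (f g y * f g z))"
      by (simp only: sum_product) (simp only: sum_distrib_left)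
    also have "\<dots> = (\<Sum>(x, y, z)\<in>A \<times> B \<times> C. f g x * (f g y * f g z))"
      by (simp only: sum.cartesian_product)
    finally show "sum (f g) A * sum (f g) B * sum (f g) C =
        (\<Sum>(x, y, z)\<in>A \<times> B \<times> C. f g (x + y + z))"
      by (simp add: assms(1) mult.assoc)
  qed simp
  also have "\<dots> = (\<Sum>(x, y, z)\<in>A \<times> B \<times> C. if x + y + z = 0 then of_nat CARD('a) else 0)"
    by (subst sum.swap) (simp add: case_prod_beta assms(2))
  also have "\<dots> = (\<Sum>(x, y, z)\<in>triples A B C. of_nat CARD('a))"
    by (intro sum.mono_neutral_cong_right) (auto simp: triples_def split: if_splits)
  finally show ?thesis by (simp add: case_prod_beta)
qed

text \<open>The map \<open>\<theta>\<close>, applied to all three entries, acts on the triples, and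
  without fixed points because it moves the first entry.\<close>

lemma even_card_triples:
  assumes "\<theta> g \<noteq> g" and "\<theta> ` B \<subseteq> B" and "\<theta> ` C \<subseteq> C"
  shows "even (card (triples {g, \<theta> g} B C))"
proof (rule even_card_involution[of _ "\<lambda>(x, y, z). (\<theta> x, \<theta> y, \<theta> z)"])
  fix t assume t: "t \<in> triples {g, \<theta> g} B C"
  then obtain x y z where xyz: "t = (x, y, z)" "x + y + z = 0" by (auto simp: triples_def)
  have "\<theta> x + \<theta> y + \<theta> z = 0" using arg_cong[OF xyz(2), of \<theta>] by (simp add: \<theta>_add)
  then show "(case t of (x, y, z) \<Rightarrow> (\<theta> x, \<theta> y, \<theta> z)) \<in> triples {g, \<theta> g} B C"
    using t xyz assms by (auto simp: triples_def)
qed (use assms in \<open>auto simp: triples_def\<close>)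

text \<open>A triple is determined by its first entry \<open>x\<close>. Two triples sharing
  \<open>x\<close> differ in both other entries or in neither; in the former case both entries are
  swapped by \<open>\<theta>\<close>, and comparison with the image of the first equation under
  \<open>\<theta>\<close> gives \<open>\<theta> x = x\<close>.\<close>

lemma card_triples_le_2:
  assumes "\<theta> g \<noteq> g" and "B \<subseteq> {b, \<theta> b}" and "C \<subseteq> {c, \<theta> c}"
  shows "card (triples {g, \<theta> g} B C) \<le> 2"
proof -
  have swap: "y' = y \<or> y' = \<theta> y" if "y \<in> {b, \<theta> b}" "y' \<in> {b, \<theta> b}" for b y y'
    using that by auto
  have "inj_on fst (triples {g, \<theta> g} B C)"
  proof (rule inj_onI)
    fix s t assume st: "s \<in> triples {g, \<theta> g} B C" "t \<in> triples {g, \<theta> g} B C" "fst s = fst t"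
    obtain x y z y' z' where s: "s = (x, y, z)" and t: "t = (x, y', z')"
      using st(3) by (cases s; cases t) auto
    have x: "x \<in> {g, \<theta> g}" and sums: "x + y + z = 0" "x + y' + z' = 0"
      and "y \<in> B" "y' \<in> B" "z \<in> C" "z' \<in> C"
      using st(1,2) unfolding s t triples_def by auto
    then have yy: "y' = y \<or> y' = \<theta> y" and zz: "z' = z \<or> z' = \<theta> z"
      using swap assms(2,3) by (meson subsetD)+
    have "\<not> (y' = \<theta> y \<and> z' = \<theta> z)"
    proof
      assume "y' = \<theta> y \<and> z' = \<theta> z"
      then have "x + (\<theta> y + \<theta> z) = \<theta> x + (\<theta> y + \<theta> z)"
        using sums(2) arg_cong[OF sums(1), of \<theta>] by (simp add: \<theta>_add add.assoc)
      then have "\<theta> x = x" by simp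
      then show False using x assms(1) by auto
    qed
    moreover have "y' = y \<longleftrightarrow> z' = z" using sums by (metis add.assoc add_left_cancel add_right_cancel)
    ultimately show "s = t" using yy zz unfolding s t by auto
  qed
  then have "card (triples {g, \<theta> g} B C) \<le> card {g, \<theta> g}"
    by (rule card_inj_on_le) (auto simp: triples_def)
  also have "\<dots> \<le> 2" by (simp add: card_insert_if)
  finally show ?thesis .
qed

lemma triples_U_empty:
  assumes "g \<notin> U" and "u \<in> U" and "v \<in> U"
  shows "triples {g, \<theta> g} {u} {v} = {}"
proof -
  have "x \<in> U" if "x + u + v = 0" for x
  proof -
    have "x + (u + v) = 0" using that by (simp only: add.assoc)
    then have "x = - (u + v)" by (simp only: eq_neg_iff_add_eq_0)
    then show ?thesis using U_uminus[OF U_add[OF assms(2,3)]] by (simp only:)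
  qed
  moreover have "\<theta> g \<notin> U" using assms(1) by (metis U_iff \<theta>_\<theta>)
  ultimately show ?thesis using assms(1) unfolding triples_def by blast
qed

lemma sum_orbit_choice:
  fixes F :: "'a \<Rightarrow> complex"
  assumes "orbit_choice \<theta> X" and "\<And>g. F (\<theta> g) = F g"
  shows "sum F X = (sum F UNIV - sum F U) / 2"
proof -
  have "U \<inter> (X \<union> \<theta> ` X) = {}" "U \<union> (X \<union> \<theta> ` X) = UNIV" "X \<inter> \<theta> ` X = {}"
    using assms(1) unfolding orbit_choice_def U_def by auto
  then have "sum F UNIV = sum F U + sum F (X \<union> \<theta> ` X)"
    by (metis finite sum.union_disjoint)
  also have "sum F (X \<union> \<theta> ` X) = 2 * sum F X"
    using assms(2) \<open>X \<inter> \<theta> ` X = {}\<close> inj_\<theta> by (intro sum_transversal) (auto intro: inj_on_subset)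
  finally show ?thesis by simp
qed

end

section \<open>The Verlinde numbers\<close>

text \<open>The joint contribution of the two copies of U, over the common denominator
  \<open>a\<^sup>2 - b\<^sup>2\<close>. The first two terms are arranged to cancel against the
  U-part missing from the sums over \<open>Gs\<close> and \<open>\<Gamma>s\<close>; only the term
  with the differences \<open>c - d\<close> survives.\<close>

lemma verlinde_coefficient:
  fixes a b :: complex
  assumes "a \<noteq> b" and "a \<noteq> - b"
  shows "((a * c1 - b * d1) / 2) * ((a * c2 - b * d2) / 2) * ((a * c3 - b * d3) / 2) / ((a - b) / 2) +
      ((a * c1 + b * d1) / 2) * ((a * c2 + b * d2) / 2) * ((a * c3 + b * d3) / 2) / ((a + b) / 2) =
      (a\<^sup>2 * (c1 * c2 * c3) + b\<^sup>2 * (d1 * d2 * d3) +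
        a\<^sup>2 * b\<^sup>2 / (a\<^sup>2 - b\<^sup>2) * ((c1 - d1) * (c2 - d2) * (c3 - d3))) / 2"
proof -
  have partial_fractions: "X / (P / 2) + Y / (Q / 2) = (R + K / (P * Q)) / 2"
    if "4 * (X * Q + Y * P) = R * (P * Q) + K" "P \<noteq> 0" "Q \<noteq> 0" for X Y P Q R K :: complex
  proof -
    have "X / (P / 2) + Y / (Q / 2) = 4 * (X * Q + Y * P) / (P * Q) / 2"
      using that(2,3) by (simp add: field_simps)
    also have "4 * (X * Q + Y * P) / (P * Q) = R + K / (P * Q)"
      unfolding that(1) using that(2,3) by (simp add: field_simps)
    finally show ?thesis .
  qed
  have "a - b \<noteq> 0" "a + b \<noteq> 0" using assms by (auto simp: eq_neg_iff_add_eq_0)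
  moreover have "a\<^sup>2 - b\<^sup>2 = (a - b) * (a + b)" by (simp add: power2_eq_square algebra_simps)
  ultimately show ?thesis
    unfolding times_divide_eq_left[of "a\<^sup>2 * b\<^sup>2"]
    by (simp only:) (intro partial_fractions, simp_all add: field_simps power2_eq_square)
qed

lemma verlinde_commute: "verlinde J S e x y z = verlinde J S e y x z"
  and verlinde_rotate: "verlinde J S e x y z = verlinde J S e y z x"
  unfolding verlinde_def by (simp_all add: mult_ac)

locale metric_pair =
  G: involutive_metric q1 \<theta>1 + \<Gamma>: involutive_metric q2 \<theta>2
  for q1 :: "'g::{ab_group_add, finite} \<Rightarrow> complex" and \<theta>1 :: "'g \<Rightarrow> 'g"
    and q2 :: "'h::{ab_group_add, finite} \<Rightarrow> complex" and \<theta>2 :: "'h \<Rightarrow> 'h" +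
  fixes \<phi> :: "'g \<Rightarrow> 'h" and Gs :: "'g set" and \<Gamma>s :: "'h set"
  assumes iso: "metric_iso G.U q1 \<Gamma>.U q2 \<phi>"
    and Gs: "orbit_choice \<theta>1 Gs" and \<Gamma>s: "orbit_choice \<theta>2 \<Gamma>s"
    and card_neq: "CARD('g) \<noteq> CARD('h)"
begin

lemma \<phi>_bij: "bij_betw \<phi> G.U \<Gamma>.U"
  and \<phi>_add: "u \<in> G.U \<Longrightarrow> v \<in> G.U \<Longrightarrow> \<phi> (u + v) = \<phi> u + \<phi> v"
  and q2_\<phi>: "u \<in> G.U \<Longrightarrow> q2 (\<phi> u) = q1 u"
  using iso by (simp_all add: metric_iso_def)

lemma \<phi>_U: "u \<in> G.U \<Longrightarrow> \<phi> u \<in> \<Gamma>.U"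
  using \<phi>_bij by (auto simp: bij_betw_def)

lemma card_U: "card \<Gamma>.U = card G.U"
  using bij_betw_same_card[OF \<phi>_bij] by simp

lemma \<phi>_0 [simp]: "\<phi> 0 = 0"
  using \<phi>_add[of 0 0] by simp

lemma \<phi>_eq_0_iff: "u \<in> G.U \<Longrightarrow> \<phi> u = 0 \<longleftrightarrow> u = 0"
  using \<phi>_bij \<phi>_0 G.U_0 unfolding bij_betw_def inj_on_def by metis

lemma pairing_\<phi>: "u \<in> G.U \<Longrightarrow> v \<in> G.U \<Longrightarrow> pairing q2 (\<phi> u) (\<phi> v) = pairing q1 u v"
  using G.U_add by (simp add: pairing_def q2_\<phi> flip: \<phi>_add)

abbreviation J :: "('g, 'h) label set" where "J \<equiv> index_set \<theta>1 Gs \<Gamma>s"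
abbreviation S :: "('g, 'h) label \<Rightarrow> ('g, 'h) label \<Rightarrow> complex" where "S \<equiv> S_matrix q1 \<theta>1 q2 \<theta>2 \<phi>"
abbreviation N :: "('g, 'h) label \<Rightarrow> ('g, 'h) label \<Rightarrow> ('g, 'h) label \<Rightarrow> complex" where
  "N \<equiv> verlinde J S (U0 0)"

definition a :: complex where "a = 1 / complex_of_real (sqrt (real CARD('g)))"
definition b :: complex where "b = 1 / complex_of_real (sqrt (real CARD('h)))"

lemma a_square: "a\<^sup>2 = 1 / of_nat CARD('g)" and b_square: "b\<^sup>2 = 1 / of_nat CARD('h)"
  by (simp_all add: a_def b_def power_divide flip: of_real_power)

lemma a_nonzero: "a \<noteq> 0" and b_nonzero: "b \<noteq> 0"
  by (simp_all add: a_def b_def)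

lemma a_neq_b: "a \<noteq> b" "a \<noteq> - b"
proof -
  have "a\<^sup>2 \<noteq> b\<^sup>2" using card_neq by (simp add: a_square b_square)
  then show "a \<noteq> b" "a \<noteq> - b" by auto
qed

text \<open>Each label is encoded by an orbit in G, an orbit in \<Gamma> and a sign, an orbit being
  empty where the column of \<open>S\<close> vanishes. This gives all four kinds of column the same
  formulas.\<close>

primrec orbit1 :: "('g, 'h) label \<Rightarrow> 'g set" where
  "orbit1 (U0 u) = {u}"
| "orbit1 (Upi u) = {u}"
| "orbit1 (InG g) = {g, \<theta>1 g}"
| "orbit1 (InGamma \<gamma>) = {}"

primrec orbit2 :: "('g, 'h) label \<Rightarrow> 'h set" where
  "orbit2 (U0 u) = {\<phi> u}"
| "orbit2 (Upi u) = {\<phi> u}"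
| "orbit2 (InG g) = {}"
| "orbit2 (InGamma \<gamma>) = {\<gamma>, \<theta>2 \<gamma>}"

text \<open>The value of \<open>sgn2\<close> at \<open>InG g\<close> is immaterial, since \<open>orbit2\<close> is empty there.\<close>

primrec sgn2 :: "('g, 'h) label \<Rightarrow> complex" where
  "sgn2 (U0 u) = 1"
| "sgn2 (Upi u) = -1"
| "sgn2 (InG g) = 1"
| "sgn2 (InGamma \<gamma>) = -1"

text \<open>Half the signed difference of the two orbit sizes, see \<open>card_orbits\<close>; it
  stems from the factors \<open>c - d\<close> of \<open>verlinde_coefficient\<close>.\<close>

primrec \<epsilon> :: "('g, 'h) label \<Rightarrow> complex" where
  "\<epsilon> (U0 u) = 0"
| "\<epsilon> (Upi u) = 1"
| "\<epsilon> (InG g) = 1"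
| "\<epsilon> (InGamma \<gamma>) = 1"

text \<open>The characters belonging to one orbit agree on the fixed points; this is their common
  restriction to U, with U embedded in \<Gamma> by \<open>\<phi>\<close>.\<close>

primrec \<chi> :: "('g, 'h) label \<Rightarrow> 'g \<Rightarrow> complex" where
  "\<chi> (U0 u) w = cnj (pairing q1 w u)"
| "\<chi> (Upi u) w = cnj (pairing q1 w u)"
| "\<chi> (InG g) w = cnj (pairing q1 w g)"
| "\<chi> (InGamma \<gamma>) w = cnj (pairing q2 (\<phi> w) \<gamma>)"

definition \<tau> :: "('g, 'h) label \<Rightarrow> ('g, 'h) label \<Rightarrow> ('g, 'h) label \<Rightarrow> complex" where
  "\<tau> x y z = (\<Sum>w\<in>G.U. \<chi> x w * \<chi> y w * \<chi> z w)"

text \<open>Up to the factor \<open>a\<close>, the entries of column \<open>x\<close> in the G-rows,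
  extended from \<open>Gs\<close> to the whole group so that orthogonality applies.\<close>

definition row1 :: "('g, 'h) label \<Rightarrow> 'g \<Rightarrow> complex" where
  "row1 x g = (\<Sum>v\<in>orbit1 x. cnj (pairing q1 g v))"

definition row2 :: "('g, 'h) label \<Rightarrow> 'h \<Rightarrow> complex" where
  "row2 x \<gamma> = (\<Sum>v\<in>orbit2 x. cnj (pairing q2 \<gamma> v))"

lemma label_cases [consumes 1, case_names U0 Upi InG InGamma]:
  assumes "x \<in> J"
  obtains u where "x = U0 u" "u \<in> G.U" | u where "x = Upi u" "u \<in> G.U"
    | g where "x = InG g" "g \<notin> G.U" | \<gamma> where "x = InGamma \<gamma>" "\<gamma> \<notin> \<Gamma>.U"
proof -
  have "g \<notin> G.U" if "g \<in> Gs" for g using that Gs by (auto simp: orbit_choice_def G.U_def)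
  moreover have "\<gamma> \<notin> \<Gamma>.U" if "\<gamma> \<in> \<Gamma>s" for \<gamma> using that \<Gamma>s by (auto simp: orbit_choice_def \<Gamma>.U_def)
  ultimately show thesis
    using assms that unfolding index_set_def G.U_def[symmetric] by (elim UnE imageE) simp_all
qed

lemma \<chi>_orbit1: "w \<in> G.U \<Longrightarrow> v \<in> orbit1 x \<Longrightarrow> cnj (pairing q1 w v) = \<chi> x w"
  by (cases x) (auto simp: G.U_iff simp flip: G.e_\<theta>_left)

lemma \<chi>_orbit2:
  assumes "x \<in> J" and "w \<in> G.U" and "v \<in> orbit2 x"
  shows "cnj (pairing q2 (\<phi> w) v) = \<chi> x w"
  using assms(1)
  by (cases rule: label_cases)
    (use assms(2,3) \<phi>_U[OF assms(2)] in \<open>auto simp: pairing_\<phi> \<Gamma>.U_iff simp flip: \<Gamma>.e_\<theta>_left\<close>)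

lemma row1_U: "w \<in> G.U \<Longrightarrow> row1 x w = of_nat (card (orbit1 x)) * \<chi> x w"
  by (simp add: row1_def \<chi>_orbit1)

lemma row2_U: "x \<in> J \<Longrightarrow> w \<in> G.U \<Longrightarrow> row2 x (\<phi> w) = of_nat (card (orbit2 x)) * \<chi> x w"
  by (simp add: row2_def \<chi>_orbit2)

lemma card_orbits:
  assumes "x \<in> J"
  shows "of_nat (card (orbit1 x)) - sgn2 x * of_nat (card (orbit2 x)) = 2 * \<epsilon> x"
  using assms by (cases rule: label_cases) (auto simp: G.U_iff \<Gamma>.U_iff)

lemma S_U0:
  assumes "x \<in> J" and "w \<in> G.U"
  shows "S (U0 w) x = (a * of_nat (card (orbit1 x)) - b * (sgn2 x * of_nat (card (orbit2 x)))) / 2 * \<chi> x w"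
  using assms(1) by (cases rule: label_cases)
    (auto simp: S_matrix_def Let_def G.U_iff \<Gamma>.U_iff a_def b_def)

lemma S_Upi:
  assumes "x \<in> J" and "w \<in> G.U"
  shows "S (Upi w) x = (a * of_nat (card (orbit1 x)) + b * (sgn2 x * of_nat (card (orbit2 x)))) / 2 * \<chi> x w"
  using assms(1) by (cases rule: label_cases)
    (auto simp: S_matrix_def Let_def G.U_iff \<Gamma>.U_iff a_def b_def)

lemma S_InG:
  assumes "x \<in> J"
  shows "S (InG g) x = a * row1 x g"
  using assms by (cases rule: label_cases)
    (auto simp: S_matrix_def Let_def G.U_iff row1_def G.e_\<theta>_left a_def)

lemma S_InGamma:
  assumes "x \<in> J"
  shows "S (InGamma \<gamma>) x = b * (sgn2 x * row2 x \<gamma>)"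
  using assms by (cases rule: label_cases)
    (auto simp: S_matrix_def Let_def \<Gamma>.U_iff row2_def \<Gamma>.e_\<theta>_left b_def add_divide_distrib diff_divide_distrib)

lemma S_unit:
  "S (U0 0) (U0 w) = (a - b) / 2" "S (U0 0) (Upi w) = (a + b) / 2"
  "S (U0 0) (InG g) = a" "S (U0 0) (InGamma \<gamma>) = b"
  by (simp_all add: S_matrix_def a_def b_def)

lemma row1_\<theta>: "row1 x (\<theta>1 g) = row1 x g" if "x \<in> J"
  using that by (cases rule: label_cases) (auto simp: row1_def G.e_\<theta>_left G.U_iff add.commute)

lemma row2_\<theta>: "row2 x (\<theta>2 \<gamma>) = row2 x \<gamma>" if "x \<in> J"
  using that \<phi>_U by (cases rule: label_cases) (auto simp: row2_def \<Gamma>.e_\<theta>_left \<Gamma>.U_iff add.commute)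

lemma sum_J:
  "sum F J = (\<Sum>w\<in>G.U. F (U0 w)) + (\<Sum>w\<in>G.U. F (Upi w)) + (\<Sum>g\<in>Gs. F (InG g)) + (\<Sum>\<gamma>\<in>\<Gamma>s. F (InGamma \<gamma>))"
proof -
  have "sum F J = sum F (U0 ` G.U) + sum F (Upi ` G.U) + sum F (InG ` Gs) + sum F (InGamma ` \<Gamma>s)"
    unfolding index_set_def G.U_def[symmetric]
    by (subst sum.union_disjoint; (auto; fail)?)+
  then show ?thesis by (simp add: sum.reindex inj_on_def)
qed

text \<open>The summand is invariant under \<open>\<theta>1\<close>, so the sum over
  \<open>Gs\<close> is half of the sum over G minus the sum over U. The former counts triples, the
  latter is a multiple of \<open>\<tau>\<close>.\<close>

lemma sum_row1:
  assumes "x \<in> J" and "y \<in> J" and "z \<in> J"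
  shows "(\<Sum>g\<in>Gs. row1 x g * row1 y g * row1 z g) =
    (of_nat CARD('g) * of_nat (card (G.triples (orbit1 x) (orbit1 y) (orbit1 z))) -
      of_nat (card (orbit1 x)) * of_nat (card (orbit1 y)) * of_nat (card (orbit1 z)) * \<tau> x y z) / 2"
proof -
  have "(\<Sum>g\<in>UNIV. row1 x g * row1 y g * row1 z g) =
      of_nat CARD('g) * of_nat (card (G.triples (orbit1 x) (orbit1 y) (orbit1 z)))"
    unfolding row1_def
  proof (rule G.sum_triples)
    show "(\<Sum>g\<in>UNIV. cnj (pairing q1 g h)) = (if h = 0 then of_nat CARD('g) else 0)" for h
      using arg_cong[OF G.sum_e[of h], of cnj] by (simp split: if_splits)
  qed (simp add: G.e_add_right)
  moreover have "(\<Sum>g\<in>G.U. row1 x g * row1 y g * row1 z g) =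
      of_nat (card (orbit1 x)) * of_nat (card (orbit1 y)) * of_nat (card (orbit1 z)) * \<tau> x y z"
    unfolding \<tau>_def sum_distrib_left by (intro sum.cong) (simp_all add: row1_U)
  ultimately show ?thesis
    using G.sum_orbit_choice[OF Gs, of "\<lambda>g. row1 x g * row1 y g * row1 z g"] assms
    by (simp add: row1_\<theta>)
qed

lemma sum_row2:
  assumes "x \<in> J" and "y \<in> J" and "z \<in> J"
  shows "(\<Sum>\<gamma>\<in>\<Gamma>s. row2 x \<gamma> * row2 y \<gamma> * row2 z \<gamma>) =
    (of_nat CARD('h) * of_nat (card (\<Gamma>.triples (orbit2 x) (orbit2 y) (orbit2 z))) -
      of_nat (card (orbit2 x)) * of_nat (card (orbit2 y)) * of_nat (card (orbit2 z)) * \<tau> x y z) / 2"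
proof -
  have "(\<Sum>g\<in>UNIV. row2 x g * row2 y g * row2 z g) =
      of_nat CARD('h) * of_nat (card (\<Gamma>.triples (orbit2 x) (orbit2 y) (orbit2 z)))"
    unfolding row2_def
  proof (rule \<Gamma>.sum_triples)
    show "(\<Sum>g\<in>UNIV. cnj (pairing q2 g h)) = (if h = 0 then of_nat CARD('h) else 0)" for h
      using arg_cong[OF \<Gamma>.sum_e[of h], of cnj] by (simp split: if_splits)
  qed (simp add: \<Gamma>.e_add_right)
  moreover have "(\<Sum>g\<in>\<Gamma>.U. row2 x g * row2 y g * row2 z g) =
      of_nat (card (orbit2 x)) * of_nat (card (orbit2 y)) * of_nat (card (orbit2 z)) * \<tau> x y z"
    unfolding \<tau>_def sum_distrib_left sum.reindex_bij_betw[OF \<phi>_bij, symmetric]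
    by (intro sum.cong) (simp_all add: row2_U assms)
  ultimately show ?thesis
    using \<Gamma>.sum_orbit_choice[OF \<Gamma>s, of "\<lambda>g. row2 x g * row2 y g * row2 z g"] assms
    by (simp add: row2_\<theta>)
qed

section \<open>Evaluation of the Verlinde sum\<close>

definition triples1 :: "('g, 'h) label \<Rightarrow> ('g, 'h) label \<Rightarrow> ('g, 'h) label \<Rightarrow> nat" where
  "triples1 x y z = card (G.triples (orbit1 x) (orbit1 y) (orbit1 z))"

definition triples2 :: "('g, 'h) label \<Rightarrow> ('g, 'h) label \<Rightarrow> ('g, 'h) label \<Rightarrow> nat" where
  "triples2 x y z = card (\<Gamma>.triples (orbit2 x) (orbit2 y) (orbit2 z))"

lemma verlinde_formula:
  assumes J: "x \<in> J" "y \<in> J" "z \<in> J"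
  shows "N x y z = 4 * (\<epsilon> x * \<epsilon> y * \<epsilon> z) * \<tau> x y z / (of_nat CARD('h) - of_nat CARD('g)) +
    of_nat (triples1 x y z) / 2 + sgn2 x * sgn2 y * sgn2 z * of_nat (triples2 x y z) / 2"
proof -
  \<comment> \<open>Here \<open>p\<close> and \<open>r\<close> stand for the squares of
    \<open>a\<close> and \<open>b\<close>, and \<open>k\<close> for the inverse of the difference of
    the orders. The terms with \<open>C\<close> and \<open>D\<close> cancel between the U-blocks and
    the two other blocks.\<close>
  have expand: "(p * C + r * D + k * (8 * e)) / 2 * T + p * ((n * t1 - C * T) / 2) +
      r * ((m * s * t2 - D * T) / 2) = 4 * k * e * T + (p * n) * t1 / 2 + (r * m) * s * t2 / 2"
    for p C r D k e T n t1 m s t2 :: complex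
    by (simp add: field_simps)
  define c d A B where c: "c = (\<lambda>x. of_nat (card (orbit1 x)) :: complex)"
    and d: "d = (\<lambda>x. sgn2 x * of_nat (card (orbit2 x)))"
    and A: "A = (\<lambda>x. (a * c x - b * d x) / 2)" and B: "B = (\<lambda>x. (a * c x + b * d x) / 2)"
  let ?T = "\<tau> x y z" and ?s = "sgn2 x * sgn2 y * sgn2 z"
  let ?t1 = "of_nat (triples1 x y z) :: complex" and ?t2 = "of_nat (triples2 x y z) :: complex"
  let ?n = "of_nat CARD('g) :: complex" and ?m = "of_nat CARD('h) :: complex"
  have SA: "S (U0 w) x = A x * \<chi> x w" and SB: "S (Upi w) x = B x * \<chi> x w"
    if "x \<in> J" "w \<in> G.U" for x w
    using that by (simp_all add: S_U0 S_Upi A B c d)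
  have "(\<Sum>w\<in>G.U. S (U0 w) x * S (U0 w) y * S (U0 w) z / S (U0 0) (U0 w)) =
      A x * A y * A z / ((a - b) / 2) * ?T"
    unfolding \<tau>_def sum_distrib_left by (intro sum.cong) (simp_all add: SA J S_unit)
  moreover have "(\<Sum>w\<in>G.U. S (Upi w) x * S (Upi w) y * S (Upi w) z / S (U0 0) (Upi w)) =
      B x * B y * B z / ((a + b) / 2) * ?T"
    unfolding \<tau>_def sum_distrib_left by (intro sum.cong) (simp_all add: SB J S_unit)
  moreover have "(\<Sum>g\<in>Gs. S (InG g) x * S (InG g) y * S (InG g) z / S (U0 0) (InG g)) =
      a\<^sup>2 * ((?n * ?t1 - c x * c y * c z * ?T) / 2)"
    unfolding triples1_def c sum_row1[OF J, symmetric] sum_distrib_left using a_nonzero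
    by (intro sum.cong) (simp_all add: S_InG J S_unit power2_eq_square)
  moreover have "(\<Sum>\<gamma>\<in>\<Gamma>s. S (InGamma \<gamma>) x * S (InGamma \<gamma>) y * S (InGamma \<gamma>) z / S (U0 0) (InGamma \<gamma>)) =
      b\<^sup>2 * (?s * ((?m * ?t2 - of_nat (card (orbit2 x)) * of_nat (card (orbit2 y)) *
        of_nat (card (orbit2 z)) * ?T) / 2))"
    unfolding triples2_def sum_row2[OF J, symmetric] sum_distrib_left using b_nonzero
    by (intro sum.cong) (simp_all add: S_InGamma J S_unit power2_eq_square)
  moreover have "?s * ((?m * ?t2 - of_nat (card (orbit2 x)) * of_nat (card (orbit2 y)) *
      of_nat (card (orbit2 z)) * ?T) / 2) = (?m * ?s * ?t2 - d x * d y * d z * ?T) / 2"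
    unfolding d by (simp add: algebra_simps)
  ultimately have "N x y z =
      (A x * A y * A z / ((a - b) / 2) + B x * B y * B z / ((a + b) / 2)) * ?T +
      a\<^sup>2 * ((?n * ?t1 - c x * c y * c z * ?T) / 2) + b\<^sup>2 * ((?m * ?s * ?t2 - d x * d y * d z * ?T) / 2)"
    unfolding verlinde_def sum_J by (simp only: distrib_right)
  also have "A x * A y * A z / ((a - b) / 2) + B x * B y * B z / ((a + b) / 2) =
      (a\<^sup>2 * (c x * c y * c z) + b\<^sup>2 * (d x * d y * d z) +
        a\<^sup>2 * b\<^sup>2 / (a\<^sup>2 - b\<^sup>2) * ((c x - d x) * (c y - d y) * (c z - d z))) / 2"
    unfolding A B by (rule verlinde_coefficient[OF a_neq_b])
  also have "(c x - d x) * (c y - d y) * (c z - d z) = 8 * (\<epsilon> x * \<epsilon> y * \<epsilon> z)"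
    unfolding c d by (simp add: card_orbits J)
  also have "a\<^sup>2 * b\<^sup>2 / (a\<^sup>2 - b\<^sup>2) = 1 / (?m - ?n)"
    using card_neq by (simp add: a_square b_square divide_simps)
  finally have "N x y z = (a\<^sup>2 * (c x * c y * c z) + b\<^sup>2 * (d x * d y * d z) +
        1 / (?m - ?n) * (8 * (\<epsilon> x * \<epsilon> y * \<epsilon> z))) / 2 * ?T +
      a\<^sup>2 * ((?n * ?t1 - c x * c y * c z * ?T) / 2) + b\<^sup>2 * ((?m * ?s * ?t2 - d x * d y * d z * ?T) / 2)" .
  also have "\<dots> = 4 * (1 / (?m - ?n)) * (\<epsilon> x * \<epsilon> y * \<epsilon> z) * ?T +
      (a\<^sup>2 * ?n) * ?t1 / 2 + (b\<^sup>2 * ?m) * ?s * ?t2 / 2"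
    by (rule expand)
  also have "a\<^sup>2 * ?n = 1" by (simp add: a_square)
  also have "b\<^sup>2 * ?m = 1" by (simp add: b_square)
  finally show ?thesis by (simp add: mult_ac)
qed

lemma \<chi>_add:
  assumes "v \<in> G.U" and "w \<in> G.U"
  shows "\<chi> x (v + w) = \<chi> x v * \<chi> x w"
  using assms by (cases x) (simp_all add: G.e_add_left \<Gamma>.e_add_left \<phi>_add)

lemma \<tau>_eq: "\<tau> x y z = (if \<forall>w\<in>G.U. \<chi> x w * \<chi> y w * \<chi> z w = 1 then of_nat (card G.U) else 0)"
  unfolding \<tau>_def using G.U_add G.U_uminus by (intro character_sum) (simp_all add: \<chi>_add)

text \<open>The product of the three characters is the character attached to the sum of a triple,
  which is 0. Hence whenever \<open>triples2\<close> could contribute negatively, the term with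
  \<open>\<tau>\<close> is at its full size, up to the factors \<open>\<epsilon>\<close>.\<close>

lemma \<tau>_eq_card:
  assumes "x \<in> J" and "y \<in> J" and "z \<in> J" and "triples2 x y z \<noteq> 0"
  shows "\<tau> x y z = of_nat (card G.U)"
proof -
  obtain p r s where p: "p \<in> orbit2 x" and r: "r \<in> orbit2 y" and s: "s \<in> orbit2 z" and sum: "p + r + s = 0"
    using assms(4) unfolding triples2_def \<Gamma>.triples_def by (auto simp: card_gt_0_iff)
  have "\<chi> x w * \<chi> y w * \<chi> z w = 1" if w: "w \<in> G.U" for w
  proof -
    have "\<chi> x w * \<chi> y w * \<chi> z w = cnj (pairing q2 (\<phi> w) (p + r + s))"
      using \<chi>_orbit2[OF assms(1) w p] \<chi>_orbit2[OF assms(2) w r] \<chi>_orbit2[OF assms(3) w s]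
      by (simp add: \<Gamma>.e_add_right)
    then show ?thesis unfolding sum by simp
  qed
  then show ?thesis unfolding \<tau>_eq by simp
qed

section \<open>Parity and size of the triple counts\<close>

lemma orbit1_invariant: "x \<in> J \<Longrightarrow> \<theta>1 ` orbit1 x \<subseteq> orbit1 x"
  by (cases rule: label_cases) (auto simp: G.U_iff)

lemma orbit2_invariant: "x \<in> J \<Longrightarrow> \<theta>2 ` orbit2 x \<subseteq> orbit2 x"
  by (cases rule: label_cases) (use \<phi>_U in \<open>auto simp: \<Gamma>.U_iff\<close>)

lemma orbit2_subset: "\<exists>v. orbit2 x \<subseteq> {v, \<theta>2 v}"
  by (cases x) auto

lemma even_triples1:
  assumes "g \<notin> G.U" and "y \<in> J" and "z \<in> J"
  shows "even (triples1 (InG g) y z)"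
  unfolding triples1_def using assms orbit1_invariant
  by (auto simp: G.U_iff intro!: G.even_card_triples)

text \<open>The action of \<open>\<theta>2\<close> makes the count even, and the projection to the
  first entry bounds it by 2.\<close>

lemma triples2_cases:
  assumes "\<gamma> \<notin> \<Gamma>.U" and "y \<in> J" and "z \<in> J"
  shows "triples2 (InGamma \<gamma>) y z = 0 \<or> triples2 (InGamma \<gamma>) y z = 2"
proof -
  have "\<theta>2 \<gamma> \<noteq> \<gamma>" using assms(1) by (simp add: \<Gamma>.U_iff)
  moreover obtain v v' where "orbit2 y \<subseteq> {v, \<theta>2 v}" "orbit2 z \<subseteq> {v', \<theta>2 v'}"
    using orbit2_subset by blast
  ultimately have "triples2 (InGamma \<gamma>) y z \<le> 2"
    unfolding triples2_def orbit2.simps by (intro \<Gamma>.card_triples_le_2)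
  moreover have "even (triples2 (InGamma \<gamma>) y z)"
    unfolding triples2_def orbit2.simps
    using \<open>\<theta>2 \<gamma> \<noteq> \<gamma>\<close> orbit2_invariant assms(2,3) by (intro \<Gamma>.even_card_triples)
  ultimately show ?thesis by (elim evenE) auto
qed

lemma triples_empty [simp]:
  "triples1 (InGamma \<gamma>) y z = 0" "triples2 (InG g) y z = 0"
  "triples2 x (InG g) z = 0" "triples2 x y (InG g) = 0"
  by (simp_all add: triples1_def triples2_def G.triples_def \<Gamma>.triples_def)

lemma triples_U:
  assumes "orbit1 x = {u}" "orbit1 y = {v}" "orbit1 z = {w}"
    and "orbit2 x = {\<phi> u}" "orbit2 y = {\<phi> v}" "orbit2 z = {\<phi> w}"
    and "u \<in> G.U" "v \<in> G.U" "w \<in> G.U"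
  shows "triples1 x y z = (if u + v + w = 0 then 1 else 0)"
    and "triples2 x y z = triples1 x y z"
proof -
  have 1: "G.triples {u} {v} {w} = (if u + v + w = 0 then {(u, v, w)} else {})"
    by (auto simp: G.triples_def)
  have "\<phi> u + \<phi> v + \<phi> w = \<phi> (u + v + w)" using assms(7-9) G.U_add by (simp add: \<phi>_add)
  then have "\<Gamma>.triples {\<phi> u} {\<phi> v} {\<phi> w} = (if u + v + w = 0 then {(\<phi> u, \<phi> v, \<phi> w)} else {})"
    using \<phi>_eq_0_iff[of "u + v + w"] assms(7-9) G.U_add by (auto simp: \<Gamma>.triples_def)
  then show "triples1 x y z = (if u + v + w = 0 then 1 else 0)" "triples2 x y z = triples1 x y z"
    using 1 assms by (simp_all add: triples1_def triples2_def)
qed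

text \<open>The only non-zero value that the first term of \<open>verlinde_formula\<close> can
  take.\<close>

definition level :: complex where
  "level = 4 * of_nat (card G.U) / (of_nat CARD('h) - of_nat CARD('g))"

lemma verlinde_formula_level:
  assumes "x \<in> J" "y \<in> J" "z \<in> J"
  obtains t where "t = 0 \<or> t = level" and "triples2 x y z \<noteq> 0 \<Longrightarrow> t = level"
    and "N x y z = \<epsilon> x * \<epsilon> y * \<epsilon> z * t + of_nat (triples1 x y z) / 2 +
      sgn2 x * sgn2 y * sgn2 z * of_nat (triples2 x y z) / 2"
proof
  let ?t = "4 * \<tau> x y z / (of_nat CARD('h) - of_nat CARD('g))"
  show "?t = 0 \<or> ?t = level" by (simp add: \<tau>_eq level_def)
  show "?t = level" if "triples2 x y z \<noteq> 0" using \<tau>_eq_card[OF assms that] by (simp add: level_def)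
  show "N x y z = \<epsilon> x * \<epsilon> y * \<epsilon> z * ?t + of_nat (triples1 x y z) / 2 +
      sgn2 x * sgn2 y * sgn2 z * of_nat (triples2 x y z) / 2"
    unfolding verlinde_formula[OF assms] by simp
qed

section \<open>Non-negative integrality in terms of the level\<close>

lemma \<epsilon>_cases: "\<epsilon> x = 0 \<or> \<epsilon> x = 1"
  by (cases x) simp_all

lemma verlinde_Nats_InG:
  assumes "level \<in> \<nat>" and "InG g \<in> J" and "y \<in> J" and "z \<in> J"
  shows "N (InG g) y z \<in> \<nat>"
proof -
  have "g \<notin> G.U" using assms(2) by (cases rule: label_cases) simp_all
  then obtain k where "triples1 (InG g) y z = 2 * k"
    using even_triples1 assms(3,4) by blast
  moreover obtain t where "t = 0 \<or> t = level" "N (InG g) y z =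
      \<epsilon> (InG g) * \<epsilon> y * \<epsilon> z * t + of_nat (triples1 (InG g) y z) / 2 +
      sgn2 (InG g) * sgn2 y * sgn2 z * of_nat (triples2 (InG g) y z) / 2"
    using verlinde_formula_level[OF assms(2-4)] .
  ultimately have "t = 0 \<or> t = level" "N (InG g) y z = \<epsilon> y * \<epsilon> z * t + of_nat k"
    by simp_all
  then show ?thesis using \<epsilon>_cases[of y] \<epsilon>_cases[of z] assms(1) by auto
qed

lemma level_minus_1:
  assumes "level \<in> \<nat>"
  shows "level - 1 \<in> \<nat>"
proof -
  obtain c where c: "level = of_nat c" using assms by (rule Nats_cases)
  have "level \<noteq> 0" using G.card_U_pos card_neq by (simp add: level_def)
  then have "level - 1 = of_nat (c - 1)" using c by (cases c) simp_all
  then show ?thesis by simp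
qed

text \<open>Here \<open>triples1\<close> vanishes. If \<open>triples2\<close> is 2, the number is 1
  when one of the other labels is of the form \<open>U0\<close>, and \<open>level - 1\<close>
  otherwise; the latter is non-negative since \<open>level\<close> is a non-zero natural
  number.\<close>

lemma verlinde_Nats_InGamma:
  assumes "level \<in> \<nat>" and "InGamma \<gamma> \<in> J" and "y \<in> J" and "z \<in> J"
  shows "N (InGamma \<gamma>) y z \<in> \<nat>"
proof -
  have \<gamma>: "\<gamma> \<notin> \<Gamma>.U" using assms(2) by (cases rule: label_cases) simp_all
  obtain t where t: "t = 0 \<or> t = level" "triples2 (InGamma \<gamma>) y z \<noteq> 0 \<Longrightarrow> t = level"
    and N: "N (InGamma \<gamma>) y z = \<epsilon> y * \<epsilon> z * t -
      sgn2 y * sgn2 z * of_nat (triples2 (InGamma \<gamma>) y z) / 2"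
    by (rule verlinde_formula_level[OF assms(2-4)]) simp
  \<comment> \<open>Two entries from U force the third into U, so two labels from the copies of U
    leave no triples.\<close>
  have U: "triples2 (InGamma \<gamma>) y z = 0"
    if "orbit2 y = {\<phi> u}" "orbit2 z = {\<phi> v}" "u \<in> G.U" "v \<in> G.U" for u v
    using \<Gamma>.triples_U_empty[OF \<gamma> \<phi>_U \<phi>_U] that by (simp add: triples2_def)
  show ?thesis
  proof (cases "triples2 (InGamma \<gamma>) y z = 0")
    case True
    then show ?thesis using N t(1) \<epsilon>_cases[of y] \<epsilon>_cases[of z] assms(1) by auto
  next
    case False
    then have 2: "triples2 (InGamma \<gamma>) y z = 2" and tl: "t = level"
      using triples2_cases[OF \<gamma> assms(3,4)] t(2) by auto
    have N': "N (InGamma \<gamma>) y z = \<epsilon> y * \<epsilon> z * level - sgn2 y * sgn2 z"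
      unfolding N 2 tl by simp
    show ?thesis
      using assms(3)
    proof (cases rule: label_cases)
      case y: (U0 u)
      show ?thesis using assms(4)
      proof (cases rule: label_cases)
        case (InGamma g)
        then show ?thesis using N' y by simp
      qed (use False U[of u] y in auto)
    next
      case y: (Upi u)
      show ?thesis using assms(4)
      proof (cases rule: label_cases)
        case (InGamma g)
        then show ?thesis using N' y level_minus_1[OF assms(1)] by simp
      qed (use False U[of u] y in auto)
    next
      case y: (InGamma g)
      show ?thesis using assms(4)
        by (cases rule: label_cases) (use N' y False level_minus_1[OF assms(1)] in auto)
    qed (use False in auto)
  qed
qed

text \<open>Both triple counts equal the same number 0 or 1, so their halves add up to it or cancel,
  according to the sign.\<close>

lemma verlinde_Nats_U:
  assumes "level \<in> \<nat>" and J: "x \<in> J" "y \<in> J" "z \<in> J"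
    and x: "orbit1 x = {u}" "orbit2 x = {\<phi> u}" "u \<in> G.U"
    and y: "orbit1 y = {v}" "orbit2 y = {\<phi> v}" "v \<in> G.U"
    and z: "orbit1 z = {w}" "orbit2 z = {\<phi> w}" "w \<in> G.U"
  shows "N x y z \<in> \<nat>"
proof -
  obtain t where t: "t = 0 \<or> t = level" and N: "N x y z = \<epsilon> x * \<epsilon> y * \<epsilon> z * t + of_nat (triples1 x y z) / 2 +
      sgn2 x * sgn2 y * sgn2 z * of_nat (triples2 x y z) / 2"
    by (rule verlinde_formula_level[OF J])
  have "triples1 x y z = (if u + v + w = 0 then 1 else 0)" "triples2 x y z = triples1 x y z"
    using triples_U[OF x(1) y(1) z(1) x(2) y(2) z(2) x(3) y(3) z(3)] by auto
  moreover have "sgn2 x * sgn2 y * sgn2 z = 1 \<or> sgn2 x * sgn2 y * sgn2 z = -1"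
    by (cases x; cases y; cases z) simp_all
  ultimately have "of_nat (triples1 x y z) / 2 + sgn2 x * sgn2 y * sgn2 z * of_nat (triples2 x y z) / 2 \<in> \<nat>"
    by auto
  moreover have "\<epsilon> x * \<epsilon> y * \<epsilon> z * t \<in> \<nat>"
    using t assms(1) \<epsilon>_cases[of x] \<epsilon>_cases[of y] \<epsilon>_cases[of z] by auto
  ultimately show ?thesis unfolding N by (simp only: add.assoc Nats_add)
qed

lemma verlinde_Nats:
  assumes "level \<in> \<nat>" and x: "x \<in> J" and y: "y \<in> J" and z: "z \<in> J"
  shows "N x y z \<in> \<nat>"
proof -
  \<comment> \<open>By the symmetry of \<open>N\<close>, a label outside the two copies of U may be
    moved to the first place.\<close>
  define inU where "inU x \<longleftrightarrow> (\<exists>u\<in>G.U. orbit1 x = {u} \<and> orbit2 x = {\<phi> u})" for x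
  have first: "N x y z \<in> \<nat>" if "x \<in> J" "\<not> inU x" "y \<in> J" "z \<in> J" for x y z
    using that(1)
  proof (cases rule: label_cases)
    case (InG g)
    then show ?thesis using verlinde_Nats_InG[OF assms(1)] that by simp
  next
    case (InGamma g)
    then show ?thesis using verlinde_Nats_InGamma[OF assms(1)] that by simp
  qed (use that in \<open>auto simp: inU_def\<close>)
  consider "\<not> inU x" | "\<not> inU y" | "\<not> inU z" | "inU x" "inU y" "inU z" by blast
  then show ?thesis
  proof cases
    case 1
    then show ?thesis using first x y z by blast
  next
    case 2
    then show ?thesis using first[of y x z] x y z by (simp add: verlinde_commute[of _ _ _ x])
  next
    case 3
    then show ?thesis using first[of z x y] x y z by (simp add: verlinde_rotate[of _ _ _ z])
  next
    case 4
    then show ?thesis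
      unfolding inU_def using verlinde_Nats_U[OF assms(1) x y z] by blast
  qed
qed

text \<open>The level is itself a Verlinde number: for three labels \<open>Upi 0\<close> both counts
  are 1, the sign is -1, and the halves cancel.\<close>

lemma verlinde_Nats_iff: "(\<forall>x\<in>J. \<forall>y\<in>J. \<forall>z\<in>J. N x y z \<in> \<nat>) \<longleftrightarrow> level \<in> \<nat>"
proof
  let ?x = "Upi 0 :: ('g, 'h) label"
  assume *: "\<forall>x\<in>J. \<forall>y\<in>J. \<forall>z\<in>J. N x y z \<in> \<nat>"
  have J: "?x \<in> J" using G.U_0 by (simp add: index_set_def G.U_def)
  have t: "triples1 ?x ?x ?x = 1" "triples2 ?x ?x ?x = 1"
    using triples_U[of ?x 0 ?x 0 ?x 0] by simp_all
  have "N ?x ?x ?x = level"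
    unfolding verlinde_formula[OF J J J] \<tau>_eq_card[OF J J J, unfolded t, OF one_neq_zero] t
    by (simp add: level_def)
  then show "level \<in> \<nat>" using * J by metis
qed (use verlinde_Nats in blast)

section \<open>Arithmetic of the orders\<close>

lemma level_Nats_iff:
  "level \<in> \<nat> \<longleftrightarrow> (\<exists>d. card \<Gamma>.H = card G.H + d \<and> (d = 1 \<or> d = 2 \<or> d = 4))"
proof -
  let ?k = "card G.U" and ?g = "card G.H" and ?h = "card \<Gamma>.H"
  have g: "CARD('g) = ?k * ?g" and h: "CARD('h) = ?k * ?h"
    using G.card_U_H \<Gamma>.card_U_H card_U by simp_all
  have neq: "?g \<noteq> ?h" using card_neq g h by auto
  then have neq': "of_nat ?h - of_nat ?g \<noteq> (0::complex)" by simp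
  have "level = (4 * of_nat ?k) / (of_nat ?k * (of_nat ?h - of_nat ?g))"
    unfolding level_def g h by (simp add: right_diff_distrib)
  then have level: "level = 4 / (of_nat ?h - of_nat ?g)"
    using G.card_U_pos by simp
  show ?thesis
  proof
    assume "level \<in> \<nat>"
    then obtain c where "4 / (of_nat ?h - of_nat ?g) = (of_nat c :: complex)"
      unfolding level by (rule Nats_cases)
    then have "4 = of_nat c * (of_nat ?h - of_nat ?g :: complex)"
      using neq' by (simp add: divide_eq_eq)
    \<comment> \<open>The equation is moved to the integers because the difference is not yet known
      to be positive; positivity follows as its product with a natural number is 4.\<close>
    then have "of_int 4 = (of_int (int c * (int ?h - int ?g)) :: complex)" by simp
    then have c: "4 = int c * (int ?h - int ?g)" by (simp only: of_int_eq_iff)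
    then have "int ?h - int ?g > 0" by (metis of_nat_0_le_iff zero_less_mult_pos zero_less_numeral not_le
          mult_nonneg_nonpos linorder_not_less)
    then obtain d where d: "?h = ?g + d" "d > 0" by (metis less_imp_add_positive of_nat_less_iff diff_gt_0_iff_gt)
    then have "4 = int (c * d)" using c by simp
    then have "4 = c * d" by linarith
    then have "d dvd 4" by (rule dvdI[OF trans[OF _ mult.commute]])
    then have "d \<le> 4" by (simp add: dvd_imp_le)
    then have "d = 1 \<or> d = 2 \<or> d = 3 \<or> d = 4" using d(2) by linarith
    moreover have "d \<noteq> 3" using \<open>d dvd 4\<close> by (intro notI) simp
    ultimately have "d = 1 \<or> d = 2 \<or> d = 4" by blast
    then show "\<exists>d. ?h = ?g + d \<and> (d = 1 \<or> d = 2 \<or> d = 4)" using d by blast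
  next
    assume "\<exists>d. ?h = ?g + d \<and> (d = 1 \<or> d = 2 \<or> d = 4)"
    then have "level = of_nat 4 \<or> level = of_nat 2 \<or> level = of_nat 1" unfolding level by auto
    then show "level \<in> \<nat>" by (metis of_nat_in_Nats)
  qed
qed

lemma U_Int_H_trivial_iff: "G.U \<inter> G.H = {0} \<longleftrightarrow> \<Gamma>.U \<inter> \<Gamma>.H = {0}"
proof -
  have U: "\<Gamma>.U = \<phi> ` G.U" using \<phi>_bij by (simp add: bij_betw_def)
  show ?thesis
    unfolding G.U_Int_H_trivial_iff_nondegenerate \<Gamma>.U_Int_H_trivial_iff_nondegenerate unfolding U
    by (simp add: pairing_\<phi> \<phi>_eq_0_iff)
qed

text \<open>On either side oddness means that \<open>U\<close> and \<open>H\<close> meet trivially,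
  that is, that the form is non-degenerate on the common subgroup U.\<close>

lemma odd_card_H_iff: "odd (card G.H) \<longleftrightarrow> odd (card \<Gamma>.H)"
  using U_Int_H_trivial_iff G.odd_card_H \<Gamma>.odd_card_H
    G.U_Int_H_trivial_if_odd \<Gamma>.U_Int_H_trivial_if_odd by blast

text \<open>The Gauss sum of U cancels from both sides of the hypothesis, and squaring removes the
  sign and the square roots. What remains compares squares of the form
  \<open>(1 + 2 * y)\<^sup>2\<close> with weights that differ by 2, contradicting that these squares
  are 1 modulo 4.\<close>

lemma card_H_neq_add_2:
  assumes gauss: "gauss_sum q1 = - gauss_sum q2" and odd: "odd (card G.H)"
  shows "card \<Gamma>.H \<noteq> card G.H + 2"
proof
  assume h: "card \<Gamma>.H = card G.H + 2"
  \<comment> \<open>A multiple of twice each order, so that \<open>y\<close> and \<open>z\<close>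
    lie in the same ring.\<close>
  define M where "M = 2 * CARD('g) * CARD('h)"
  have G: "G.U \<inter> G.H = {0}" using G.U_Int_H_trivial_if_odd odd by blast
  then have \<Gamma>: "\<Gamma>.U \<inter> \<Gamma>.H = {0}" using U_Int_H_trivial_iff by blast
  obtain y where y: "y \<in> cyclotomic_integers M" "sum q1 G.H = 1 + 2 * y"
    using G.sum_q_H[OF G, of M] by (auto simp: M_def)
  obtain z where z: "z \<in> cyclotomic_integers M" "sum q2 \<Gamma>.H = 1 + 2 * z"
    using \<Gamma>.sum_q_H[OF \<Gamma>, of M] by (auto simp: M_def)
  let ?g = "of_nat (card G.H) :: complex" and ?u = "sum q1 G.U"
  let ?X = "sum q1 G.H" and ?Y = "sum q2 \<Gamma>.H" and ?k = "of_nat (card G.U) :: complex"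
  have u: "sum q2 \<Gamma>.U = ?u"
    unfolding sum.reindex_bij_betw[OF \<phi>_bij, symmetric] by (intro sum.cong) (simp_all add: q2_\<phi>)
  have "gauss_sum q1 = a * (?u * ?X)" "gauss_sum q2 = b * (?u * ?Y)"
    unfolding gauss_sum_def G.sum_q_decompose[OF G] \<Gamma>.sum_q_decompose[OF \<Gamma>] u
    by (simp_all add: a_def b_def)
  then have "?u * (a * ?X) = ?u * (- (b * ?Y))" using gauss by (simp add: mult_ac)
  moreover have "?u \<noteq> 0" using G.gauss_sum_nonzero G.sum_q_decompose[OF G] by auto
  ultimately have "a * ?X = - (b * ?Y)" by (metis mult_left_cancel)
  then have "(a * ?X)\<^sup>2 = (b * ?Y)\<^sup>2" by simp
  then have "a\<^sup>2 * ?X\<^sup>2 = b\<^sup>2 * ?Y\<^sup>2" by (simp only: power_mult_distrib)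
  then have "?X\<^sup>2 / (?k * ?g) = ?Y\<^sup>2 / (?k * (?g + 2))"
    unfolding a_square b_square G.card_U_H \<Gamma>.card_U_H card_U h by (simp add: distrib_left)
  moreover have "?k \<noteq> 0" using G.card_U_pos by simp
  moreover have "?g \<noteq> 0" using odd by (intro notI) simp
  moreover have "?g + 2 \<noteq> 0" using of_nat_eq_0_iff[of "card G.H + 2", where ?'a = complex] by (simp add: add.commute)
  moreover have "h * x = g * y" if "x / (k * g) = y / (k * h)" "k \<noteq> 0" "g \<noteq> 0" "h \<noteq> 0"
    for g h k x y :: complex
    using that by (simp add: field_simps)
  ultimately have "(?g + 2) * ?X\<^sup>2 = ?g * ?Y\<^sup>2" by blast
  then have "(?g + 2) * (1 + 2 * y)\<^sup>2 = ?g * (1 + 2 * z)\<^sup>2" unfolding y(2) z(2) .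
  \<comment> \<open>Expanding and cancelling \<open>?g\<close> leaves 2 equal to a multiple of 4;
    division by 2 exhibits an inverse of 2 in the ring.\<close>
  then have "2 * (?g * (z + z * z) - (?g + 2) * (y + y * y)) = 1" by algebra
  moreover have "?g * (z + z * z) - (?g + 2) * (y + y * y) \<in> cyclotomic_integers M"
    using y(1) z(1) cyclotomic_integers_of_nat[of "card G.H" M] cyclotomic_integers_of_nat[of 2 M]
    by (intro cyclotomic_integers.diff cyclotomic_integers_mult cyclotomic_integers_add) simp_all
  moreover have "M > 0" by (simp add: M_def)
  ultimately show False using two_not_unit_cyclotomic_integers by blast
qed

end

theorem theorem3p6:
  fixes q1 :: "'g::{ab_group_add, finite} \<Rightarrow> complex" and \<theta>1 :: "'g \<Rightarrow> 'g"
    and q2 :: "'h::{ab_group_add, finite} \<Rightarrow> complex" and \<theta>2 :: "'h \<Rightarrow> 'h"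
    and \<phi> :: "'g \<Rightarrow> 'h" and Gs :: "'g set" and \<Gamma>s :: "'h set"
  assumes "involutive_metric_group q1 \<theta>1"
    and "involutive_metric_group q2 \<theta>2"
    and "CARD('g) \<noteq> CARD('h)"
    and "gauss_sum q1 = - gauss_sum q2"
    and "metric_iso (fixed_points \<theta>1) q1 (fixed_points \<theta>2) q2 \<phi>"
    and "orbit_choice \<theta>1 Gs"
    and "orbit_choice \<theta>2 \<Gamma>s"
  defines "U \<equiv> fixed_points \<theta>1"
    and "J \<equiv> index_set \<theta>1 Gs \<Gamma>s"
    and "S \<equiv> S_matrix q1 \<theta>1 q2 \<theta>2 \<phi>"
  shows "(\<forall>x\<in>J. \<forall>y\<in>J. \<forall>z\<in>J. verlinde J S (U0 0) x y z \<in> \<nat>) \<longleftrightarrow>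
    CARD('h) = CARD('g) + 4 * card U \<or>
    CARD('h) = CARD('g) + 2 * card U \<and> even (CARD('g) div card U)"
proof -
  interpret G: involutive_metric q1 \<theta>1 using assms(1) by unfold_locales
  interpret \<Gamma>: involutive_metric q2 \<theta>2 using assms(2) by unfold_locales
  interpret metric_pair q1 \<theta>1 q2 \<theta>2 \<phi> Gs \<Gamma>s
    using assms(3,5-7) by unfold_locales (simp_all add: G.U_def \<Gamma>.U_def)
  let ?g = "card G.H" and ?h = "card \<Gamma>.H"
  have U: "U = G.U" by (simp add: U_def G.U_def)
  have g: "CARD('g) = card U * ?g" and h: "CARD('h) = card U * ?h" and k: "card U > 0"
    using G.card_U_H \<Gamma>.card_U_H card_U G.card_U_pos by (simp_all add: U)
  have orders: "CARD('h) = CARD('g) + d * card U \<longleftrightarrow> ?h = ?g + d" for d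
  proof -
    have "CARD('g) + d * card U = card U * (?g + d)" unfolding g by (simp add: algebra_simps)
    then show ?thesis unfolding h using k by (simp add: U)
  qed
  have quotient: "CARD('g) div card U = ?g" unfolding g using k by (simp add: U)
  have "(\<forall>x\<in>J. \<forall>y\<in>J. \<forall>z\<in>J. verlinde J S (U0 0) x y z \<in> \<nat>) \<longleftrightarrow>
      (\<exists>d. ?h = ?g + d \<and> (d = 1 \<or> d = 2 \<or> d = 4))"
    unfolding J_def S_def verlinde_Nats_iff level_Nats_iff ..
  \<comment> \<open>The equal parity of \<open>?g\<close> and \<open>?h\<close> excludes
    \<open>d = 1\<close>, and the Gauss sums exclude \<open>d = 2\<close> for odd
    \<open>?g\<close>.\<close>
  also have "\<dots> \<longleftrightarrow> ?h = ?g + 4 \<or> ?h = ?g + 2 \<and> even ?g"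
    using card_H_neq_add_2[OF assms(4)] odd_card_H_iff by auto
  finally show ?thesis unfolding orders quotient .
qed

end
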